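(* There exist some absolute constants $C,c>0$ such that $$\inf_{\hat\Sigma}\ \sup_{\Sigma\in\mathcal{F}(M)}\ \sup_Q\ \mathbb{P}_{(\epsilon,\Sigma,Q)}\left\{\|\hat\Sigma-\Sigma\|_{\rm op}^2\ge C\left(\frac pn\vee\epsilon^2\right)\right\}\ge c,$$ for any $\epsilon\in[0,1]$. Here the infimum is over all estimators $\hat\Sigma=\hat\Sigma(X_1,\dots,X_n)$ and $Q$ ranges over all probability distributions on $\mathbb{R}^p$.
   Context: For $\epsilon\in[0,1]$, a covariance matrix $\Sigma\in\mathbb{R}^{p\times p}$ and a probability distribution $Q$ on $\mathbb{R}^p$, $\mathbb{P}_{(\epsilon,\Sigma,Q)}=(1-\epsilon)N(0,\Sigma)+\epsilon Q$; $X_1,\dots,X_n$ are i.i.d. from this distribution, and the same symbol denotes their joint law. $\mathcal{F}(M)=\{\Sigma=\Sigma^T\in\mathbb{R}^{p\times p}:\Sigma\succeq0,\ s_{\max}(\Sigma)\le M\}$, where $s_{\max}$ is the largest singular value and $M>0$ is some absolute constant that does not scale with $p$ or $n$. $\|\cdot\|_{\rm op}$ is the operator norm and $a\vee b=\max(a,b)$.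
   Formalization: Proved for p/n ≤ K with K arbitrary and C, c depending only on M and K; without a bound on p/n the claim fails, since the zero estimator has squared loss at most M², making the event empty once Cp/n > M². *)

theory Defs
  imports
    "HOL-Probability.Probability"
    "Jordan_Normal_Form.Spectral_Radius"
begin

(* The constants of the theorem must not depend on the dimension p, so p is a natural number and
   not a type: a point of R^p is an extensional function on {..<p}, a p x p matrix is an element
   of carrier_mat p p. *)

abbreviation borel_pow :: "nat \<Rightarrow> (nat \<Rightarrow> real) measure" where
  "borel_pow p \<equiv> Pi\<^sub>M {..<p} (\<lambda>_. borel)"

definition vec_l2norm :: "real Matrix.vec \<Rightarrow> real" where
  "vec_l2norm v = sqrt (scalar_prod v v)"

definition op_norm :: "real mat \<Rightarrow> real" where
  "op_norm A = (SUP v \<in> {v \<in> carrier_vec (dim_col A). vec_l2norm v \<le> 1}. vec_l2norm (A *\<^sub>v v))"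

definition singular_values :: "real mat \<Rightarrow> real set" where
  "singular_values A = sqrt ` spectrum (transpose_mat A * A)"

(* Max is only meaningful when A has at least one column. *)
definition s_max :: "real mat \<Rightarrow> real" where
  "s_max A = Max (singular_values A)"

definition pos_semidef :: "nat \<Rightarrow> real mat \<Rightarrow> bool" where
  "pos_semidef p A \<longleftrightarrow> (\<forall>v \<in> carrier_vec p. 0 \<le> scalar_prod v (A *\<^sub>v v))"

definition cov_class :: "nat \<Rightarrow> real \<Rightarrow> real mat set" where
  "cov_class p M =
     {\<Sigma> \<in> carrier_mat p p. transpose_mat \<Sigma> = \<Sigma> \<and> pos_semidef p \<Sigma> \<and> s_max \<Sigma> \<le> M}"

definition linear_image :: "nat \<Rightarrow> real mat \<Rightarrow> (nat \<Rightarrow> real) \<Rightarrow> nat \<Rightarrow> real" where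
  "linear_image p A z = (\<lambda>i\<in>{..<p}. \<Sum>j<p. A $$ (i, j) * z j)"

(* N(0, Sigma), possibly degenerate: the law of A Z, where Z is standard normal on R^p and
   A A^T = Sigma. Such an A exists for every symmetric positive semidefinite Sigma, and the law
   does not depend on which one is chosen. *)
definition mvn :: "nat \<Rightarrow> real mat \<Rightarrow> (nat \<Rightarrow> real) measure" where
  "mvn p \<Sigma> =
     distr (Pi\<^sub>M {..<p} (\<lambda>_. density lborel std_normal_density)) (borel_pow p)
       (linear_image p (SOME A. A \<in> carrier_mat p p \<and> A * transpose_mat A = \<Sigma>))"

definition distributions :: "nat \<Rightarrow> (nat \<Rightarrow> real) measure set" where
  "distributions p = {Q. prob_space Q \<and> sets Q = sets (borel_pow p)}"

definition contaminated ::
  "nat \<Rightarrow> real \<Rightarrow> real mat \<Rightarrow> (nat \<Rightarrow> real) measure \<Rightarrow> (nat \<Rightarrow> real) measure" where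
  "contaminated p \<epsilon> \<Sigma> Q =
     measure_of (space (borel_pow p)) (sets (borel_pow p))
       (\<lambda>B. ennreal (1 - \<epsilon>) * emeasure (mvn p \<Sigma>) B + ennreal \<epsilon> * emeasure Q B)"

definition sample_law ::
  "nat \<Rightarrow> nat \<Rightarrow> real \<Rightarrow> real mat \<Rightarrow> (nat \<Rightarrow> real) measure \<Rightarrow> (nat \<Rightarrow> nat \<Rightarrow> real) measure" where
  "sample_law n p \<epsilon> \<Sigma> Q = Pi\<^sub>M {..<n} (\<lambda>_. contaminated p \<epsilon> \<Sigma> Q)"

definition estimators :: "nat \<Rightarrow> nat \<Rightarrow> ((nat \<Rightarrow> nat \<Rightarrow> real) \<Rightarrow> real mat) set" where
  "estimators n p =
     {S. (\<forall>x \<in> space (Pi\<^sub>M {..<n} (\<lambda>_. borel_pow p)). S x \<in> carrier_mat p p) \<and>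
         (\<forall>i<p. \<forall>j<p. (\<lambda>x. S x $$ (i, j)) \<in> borel_measurable (Pi\<^sub>M {..<n} (\<lambda>_. borel_pow p)))}"

lemma sets_mvn [measurable_cong]: "sets (mvn p \<Sigma>) = sets (borel_pow p)"
  by (simp add: mvn_def)

lemma measurable_linear_image:
  "linear_image p A \<in> measurable (Pi\<^sub>M {..<p} (\<lambda>_. density lborel std_normal_density)) (borel_pow p)"
proof -
  have "linear_image p A \<in> measurable (borel_pow p) (borel_pow p)"
    unfolding linear_image_def by measurable
  moreover have "sets (Pi\<^sub>M {..<p} (\<lambda>_. density lborel std_normal_density)) = sets (borel_pow p)"
    by (intro sets_PiM_cong) auto
  ultimately show ?thesis
    using measurable_cong_sets by blast
qed

lemma prob_space_mvn: "prob_space (mvn p \<Sigma>)"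
  unfolding mvn_def
  by (intro prob_space.prob_space_distr prob_space_PiM prob_space_normal_density
      measurable_linear_image) auto

lemma sets_contaminated [measurable_cong]:
  "sets (contaminated p \<epsilon> \<Sigma> Q) = sets (borel_pow p)"
  unfolding contaminated_def by (rule sets.sets_measure_of_eq)

lemma space_contaminated: "space (contaminated p \<epsilon> \<Sigma> Q) = space (borel_pow p)"
  by (rule sets_eq_imp_space_eq[OF sets_contaminated])

lemma emeasure_contaminated:
  assumes "Q \<in> distributions p" "B \<in> sets (borel_pow p)"
  shows "emeasure (contaminated p \<epsilon> \<Sigma> Q) B =
    ennreal (1 - \<epsilon>) * emeasure (mvn p \<Sigma>) B + ennreal \<epsilon> * emeasure Q B"
  unfolding contaminated_def
proof (rule emeasure_measure_of_sigma)
  have Q: "sets Q = sets (borel_pow p)" using assms(1) by (simp add: distributions_def)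
  show "sigma_algebra (space (borel_pow p)) (sets (borel_pow p))" ..
  show "countably_additive (sets (borel_pow p))
      (\<lambda>B. ennreal (1 - \<epsilon>) * emeasure (mvn p \<Sigma>) B + ennreal \<epsilon> * emeasure Q B)"
  proof (rule countably_additiveI)
    fix A :: "nat \<Rightarrow> (nat \<Rightarrow> real) set"
    assume A: "range A \<subseteq> sets (borel_pow p)" "disjoint_family A"
    have "(\<Sum>i. emeasure (mvn p \<Sigma>) (A i)) = emeasure (mvn p \<Sigma>) (\<Union>i. A i)"
      "(\<Sum>i. emeasure Q (A i)) = emeasure Q (\<Union>i. A i)"
      using A by (auto intro!: suminf_emeasure simp: sets_mvn Q)
    then show "(\<Sum>i. ennreal (1 - \<epsilon>) * emeasure (mvn p \<Sigma>) (A i) + ennreal \<epsilon> * emeasure Q (A i)) =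
        ennreal (1 - \<epsilon>) * emeasure (mvn p \<Sigma>) (\<Union>i. A i) + ennreal \<epsilon> * emeasure Q (\<Union>i. A i)"
      by (simp add: suminf_add[OF summableI summableI, symmetric] ennreal_suminf_cmult)
  qed
qed (use assms in \<open>auto simp: positive_def\<close>)

lemma prob_space_contaminated:
  assumes "Q \<in> distributions p" "\<epsilon> \<in> {0..1}"
  shows "prob_space (contaminated p \<epsilon> \<Sigma> Q)"
proof
  have Q: "prob_space Q" "space Q = space (borel_pow p)"
    using assms(1) by (auto simp: distributions_def dest: sets_eq_imp_space_eq)
  have "emeasure (mvn p \<Sigma>) (space (borel_pow p)) = 1" "emeasure Q (space (borel_pow p)) = 1"
    using prob_space.emeasure_space_1[OF prob_space_mvn] sets_eq_imp_space_eq[OF sets_mvn]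
      prob_space.emeasure_space_1[OF Q(1)] Q(2) by metis+
  then show "emeasure (contaminated p \<epsilon> \<Sigma> Q) (space (contaminated p \<epsilon> \<Sigma> Q)) = 1"
    using assms by (simp add: space_contaminated emeasure_contaminated ennreal_plus[symmetric]
        del: ennreal_plus)
qed

end

theory Submission
  imports Defs
begin

text \<open>
  Each of the two terms in the rate comes from families of covariance matrices that no estimator can
  tell apart; since the maximum is one of the two, they can be treated separately. Contamination by the
  normal law itself leaves the data Gaussian, so the term \<open>p / n\<close> is a statement about ordinary Gaussian samples; the
  term \<open>\<epsilon>\<^sup>2\<close> is an exact identification failure.

  For \<open>\<epsilon>\<^sup>2\<close>, take the variances \<open>\<tau>\<^sup>2 = M\<close> and \<open>\<sigma>\<^sup>2 = (1 - \<epsilon> / 2)\<^sup>2 M\<close> along one axis. The density of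
  \<open>N(0, \<tau>\<^sup>2)\<close> is at least \<open>\<sigma> / \<tau> \<ge> 1 - \<epsilon>\<close> times that of \<open>N(0, \<sigma>\<^sup>2)\<close>. So an adversary with budget \<open>\<epsilon>\<close>
  can fill up \<open>N(0, \<sigma>\<^sup>2)\<close> to \<open>N(0, \<tau>\<^sup>2)\<close> exactly (\<open>contaminated_eq_of_dominated\<close>), although the variances
  differ by order \<open>\<epsilon>\<close>.

  For \<open>p / n\<close> with \<open>p \<ge> 2\<close>, let the coordinate \<open>0\<close> be a linear regression on the other \<open>p - 1\<close>
  coordinates, with coefficients \<open>\<plusminus>\<eta>\<close> and \<open>\<eta>\<^sup>2\<close> of order \<open>1 / n\<close>. The operator norm dominates the
  Euclidean norm of the first row, where every wrong sign costs order \<open>\<eta>\<^sup>2\<close>. Assouad's method (\<open>assouad\<close>)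
  then needs only that a single sign cannot be tested from \<open>n\<close> observations. This follows from the
  Hellinger affinity (\<open>hellinger_testing_bound\<close>), which is multiplicative over the sample and is at
  least \<open>1 - \<eta>\<^sup>2 / 2\<close> for one observation (\<open>gauss_shear_testing\<close>). The bound on \<open>p / n\<close> keeps the
  coefficient vector bounded, hence the covariance in the class. For \<open>p = 1\<close> two variances at distance
  of order \<open>1 / \<surd>n\<close> do the same (\<open>minimax_lower_bound_sampling\<close>).

  Two facts behind the definitions carry weight. The law \<open>N(0, \<Sigma>)\<close> is given by an arbitrary square
  root of \<open>\<Sigma>\<close>; that the choice is immaterial (\<open>mvn_gram\<close>) rests on the uniqueness of multivariate
  characteristic functions. And the loss is a supremum over uncountably many vectors, whose
  measurability (\<open>borel_measurable_op_norm\<close>) is needed for the probability of an error to mean anything.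
\<close>

section \<open>The Gaussian law depends only on the covariance matrix\<close>

lemma integrable_bounded_times_iexp:
  fixes g :: "'a \<Rightarrow> real"
  assumes "prob_space M" "f \<in> borel_measurable M" "g \<in> borel_measurable M"
    and "\<And>x. \<bar>g x\<bar> \<le> c"
  shows "integrable M (\<lambda>x. complex_of_real (g x) * iexp (f x))"
proof -
  interpret prob_space M by fact
  show ?thesis
    using assms by (intro integrable_const_bound[of _ c]) (auto simp: norm_mult)
qed

text \<open>
  Normalising \<open>g\<close> to a probability density reduces the claim to the uniqueness of one-dimensional
  characteristic functions. Weights are needed because the multivariate uniqueness theorem below
  treats one coordinate at a time, with the other coordinates absorbed into \<open>g\<close>.
\<close>
lemma weighted_charfun_determines_law:
  fixes g X :: "'a \<Rightarrow> real"
  assumes "prob_space M" "prob_space N"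
    and [measurable]: "X \<in> borel_measurable M" "X \<in> borel_measurable N"
      "g \<in> borel_measurable M" "g \<in> borel_measurable N"
    and g0: "\<And>x. 0 \<le> g x" and gc: "\<And>x. g x \<le> c"
    and eq: "\<And>s. (CLINT x|M. of_real (g x) * iexp (s * X x)) = (CLINT x|N. of_real (g x) * iexp (s * X x))"
    and [measurable]: "A \<in> sets borel"
  shows "(LINT x|M. g x * indicator A (X x)) = (LINT x|N. g x * indicator A (X x))"
proof -
  interpret M: prob_space M by fact
  interpret N: prob_space N by fact
  have intM: "integrable M g" and intN: "integrable N g"
    using g0 gc by (auto intro!: M.integrable_const_bound[of _ c] N.integrable_const_bound[of _ c])
  define m where "m = (LINT x|M. g x)"
  have mN: "m = (LINT x|N. g x)"
    using eq[of 0] by (simp add: m_def)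
  have m0: "0 \<le> m" unfolding m_def using g0 by simp
  have aux: "(LINT x|M. g x * indicator A (X x)) = 0" if "prob_space M" "integrable M g"
    "(LINT x|M. g x) = 0" "g \<in> borel_measurable M" "X \<in> borel_measurable M" for M
  proof -
    have "AE x in M. g x = 0"
      using integral_nonneg_eq_0_iff_AE[of M g] that g0 by auto
    then have "(LINT x|M. g x * indicator A (X x)) = (LINT x|M. 0)"
      using that by (intro integral_cong_AE) auto
    then show ?thesis by simp
  qed
  show ?thesis
  proof (cases "m = 0")
    case True
    then show ?thesis
      using aux[OF assms(1) intM] aux[OF assms(2) intN] mN by (simp add: m_def)
  next
    case False
    then have m: "m > 0" using m0 by simp
    define law where "law L = distr (density L (\<lambda>x. ennreal (g x / m))) borel X" for L
    have law: "real_distribution (law L)"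
      "char (law L) t = (CLINT x|L. of_real (g x) * iexp (t * X x)) / of_real m"
      "measure (law L) A = (LINT x|L. g x * indicator A (X x)) / m"
      if L: "prob_space L" "integrable L g" "(LINT x|L. g x) = m"
        and [measurable]: "g \<in> borel_measurable L" "X \<in> borel_measurable L" for L t
    proof -
      interpret L: prob_space L by fact
      have "(\<integral>\<^sup>+x. ennreal (g x / m) \<partial>L) = 1"
        using L m g0 by (subst nn_integral_eq_integral) auto
      then have "prob_space (density L (\<lambda>x. ennreal (g x / m)))"
        by (intro prob_spaceI) (simp add: emeasure_density cong: nn_integral_cong)
      then interpret D: prob_space "density L (\<lambda>x. ennreal (g x / m))" .
      interpret R: prob_space "law L"
        unfolding law_def by (rule D.prob_space_distr) simp
      show "real_distribution (law L)"
        by standard (auto simp: law_def)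
      have "char (law L) t = (CLINT x|density L (\<lambda>x. ennreal (g x / m)). iexp (t * X x))"
        unfolding char_def law_def by (subst integral_distr) auto
      also have "\<dots> = (CLINT x|L. (g x / m) *\<^sub>R iexp (t * X x))"
        using g0 m by (subst integral_density) auto
      also have "\<dots> = (CLINT x|L. of_real (g x) * iexp (t * X x) / of_real m)"
        by (intro Bochner_Integration.integral_cong) (auto simp: scaleR_conv_of_real)
      finally show "char (law L) t = (CLINT x|L. of_real (g x) * iexp (t * X x)) / of_real m"
        by simp
      have "measure (law L) A = (LINT x|law L. indicator A x)"
        by (simp add: law_def)
      also have "\<dots> = (LINT x|density L (\<lambda>x. ennreal (g x / m)). indicator A (X x))"
        unfolding law_def by (subst integral_distr) auto
      also have "\<dots> = (LINT x|L. (g x / m) *\<^sub>R indicator A (X x))"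
        using g0 m by (subst integral_density) auto
      also have "\<dots> = (LINT x|L. (g x * indicator A (X x)) / m)"
        by (intro Bochner_Integration.integral_cong) auto
      finally show "measure (law L) A = (LINT x|L. g x * indicator A (X x)) / m"
        by simp
    qed
    have "law M = law N"
      using law(1,2)[OF assms(1) intM] law(1,2)[OF assms(2) intN] eq
      by (intro Levy_uniqueness) (auto simp: m_def[symmetric] mN[symmetric])
    then show ?thesis
      using law(3)[OF assms(1) intM] law(3)[OF assms(2) intN] m
      by (auto simp: m_def[symmetric] mN[symmetric])
  qed
qed

text \<open>
  Uniqueness of characteristic functions on \<open>\<real>\<^sup>p\<close>, deduced from the one-dimensional case by induction
  over the coordinates.
\<close>
lemma charfun_determines_law_PiM:
  assumes "prob_space M" "prob_space N"
    and sM: "sets M = sets (borel_pow p)" and sN: "sets N = sets (borel_pow p)"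
    and eq: "\<And>t. (CLINT x|M. iexp (\<Sum>j<p. t j * x j)) = (CLINT x|N. iexp (\<Sum>j<p. t j * x j))"
  shows "M = N"
proof -
  interpret M: prob_space M by fact
  interpret N: prob_space N by fact
  note [measurable_cong] = sM sN
  define w :: "(nat \<Rightarrow> real set) \<Rightarrow> nat \<Rightarrow> (nat \<Rightarrow> real) \<Rightarrow> real"
    where "w A k x = (\<Prod>j\<in>{k..<p}. indicator (A j) (x j))" for A k x
  define u where "u t k x = (\<Sum>j<k. t j * x j)" for t :: "nat \<Rightarrow> real" and k and x :: "nat \<Rightarrow> real"
  have w01: "0 \<le> w A k x" "w A k x \<le> 1" for A k x
    unfolding w_def by (auto intro!: prod_nonneg prod_le_1)
  have mw: "w A k \<in> borel_measurable (borel_pow p)" if "\<And>j. A j \<in> sets borel" for A k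
    unfolding w_def using that by measurable
  have mu: "u t k \<in> borel_measurable (borel_pow p)" if "k \<le> p" for t k
    unfolding u_def using that by (intro borel_measurable_sum borel_measurable_times borel_measurable_const measurable_component_singleton) auto
  (* Replacing the exponentials in the coordinates k, ..., p - 1 by indicators, one at a time from the
     top: k = p is the hypothesis and k = 0 compares the measures of a box. *)
  have boxes: "(CLINT x|M. of_real (w A k x) * iexp (u t k x)) = (CLINT x|N. of_real (w A k x) * iexp (u t k x))"
    if "k \<le> p" and A: "\<And>j. A j \<in> sets borel" for k t A
    using that(1)
  proof (induction k arbitrary: t rule: inc_induct)
    case base
    then show ?case using eq[of t] by (simp add: w_def u_def)
  next
    case (step k)
    note IH = step.IH
    have kp: "k < p" by fact
    let ?w = "w A (Suc k)" and ?u = "u t k"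
    have wk: "w A k x = indicator (A k) (x k) * ?w x" for x
      unfolding w_def using kp by (simp add: prod.atLeast_Suc_lessThan)
    note [measurable] = mw[OF A] mu[of k] A
    have [measurable]: "(\<lambda>x. x k) \<in> borel_measurable (borel_pow p)" using kp by (intro measurable_component_singleton) simp
    have [measurable]: "?u \<in> borel_measurable (borel_pow p)" using kp by (intro mu) simp
    have [measurable]: "?w \<in> borel_measurable (borel_pow p)" by (rule mw[OF A])
    have plain: "(CLINT x|M. of_real (?w x) * iexp (r * ?u x + s * x k))
        = (CLINT x|N. of_real (?w x) * iexp (r * ?u x + s * x k))" for r s
    proof -
      have "u (\<lambda>j. if j = k then s else r * t j) (Suc k) x = r * ?u x + s * x k" for x
        by (simp add: u_def sum_distrib_left mult_ac)
      then show ?thesis using IH[of "\<lambda>j. if j = k then s else r * t j"] by simp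
    qed
    have int: "integrable L (\<lambda>x. of_real (?w x) * iexp (r * ?u x + s * x k))"
      if "L = M \<or> L = N" for L r s
      using that assms(1,2) w01 by (auto simp del: of_real_add of_real_mult intro!: integrable_bounded_times_iexp[of _ _ _ 1])
    (* A complex weight defines no probability law. The weights 1 + Re (z * iexp u) are nonnegative,
       and expanding the real part writes their integrals through those for u, -u and 0. *)
    have weight: "(CLINT x|M. of_real (?w x * (1 + Re (z * iexp (?u x)))) * iexp (s * x k))
        = (CLINT x|N. of_real (?w x * (1 + Re (z * iexp (?u x)))) * iexp (s * x k))" for z s
    proof -
      have *: "of_real (?w x * (1 + Re (z * iexp (?u x)))) * iexp (s * x k)
        = of_real (?w x) * iexp (0 * ?u x + s * x k)
          + (z / 2) * (of_real (?w x) * iexp (1 * ?u x + s * x k))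
          + (cnj z / 2) * (of_real (?w x) * iexp ((-1) * ?u x + s * x k))" for x
      proof -
        have c: "complex_of_real (Re (z * iexp (?u x))) = (z * iexp (1 * ?u x) + cnj z * iexp ((-1) * ?u x)) / 2"
          by (simp add: complex_eq_iff Re_exp Im_exp)
        have e: "iexp (r * ?u x + s * x k) = iexp (r * ?u x) * iexp (s * x k)" for r
          by (simp add: distrib_left exp_add)
        have gen: "W * (1 + (z * a + z' * b) / 2) * e = W * (1 * e) + (z / 2) * (W * (a * e)) + (z' / 2) * (W * (b * e))"
          for W a b e z z' :: complex
          by (simp add: field_simps)
        have "of_real (?w x * (1 + Re (z * iexp (?u x)))) * iexp (s * x k)
          = of_real (?w x) * (1 + (z * iexp (1 * ?u x) + cnj z * iexp ((-1) * ?u x)) / 2) * iexp (s * x k)"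
          by (simp only: of_real_mult of_real_add of_real_1 c)
        also note gen
        finally show ?thesis by (simp only: e) (simp only: mult_zero_left of_real_0 mult_zero_right exp_zero)
      qed
      show ?thesis
        unfolding * by (simp only: Bochner_Integration.integral_add Bochner_Integration.integrable_add
            integrable_mult_right int integral_mult_right_zero plain simp_thms)
    qed
    have Re_le: "\<bar>Re (z * iexp (?u x))\<bar> \<le> 1" if "norm z \<le> 1" for x z
    proof -
      have "norm (z * iexp (?u x)) \<le> 1" using that by (simp add: norm_mult)
      then show ?thesis using abs_Re_le_cmod order_trans by blast
    qed
    have shifted: "(LINT x|M. (?w x * (1 + Re (z * iexp (?u x)))) * indicator (A k) (x k))
        = (LINT x|N. (?w x * (1 + Re (z * iexp (?u x)))) * indicator (A k) (x k))"
      if "norm z \<le> 1" for z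
    proof (rule weighted_charfun_determines_law[OF assms(1,2)])
      fix x
      show "0 \<le> ?w x * (1 + Re (z * iexp (?u x)))"
        using Re_le[OF that, of x] w01 by (intro mult_nonneg_nonneg) auto
      have "?w x * (1 + Re (z * iexp (?u x))) \<le> 1 * 2"
        using Re_le[OF that, of x] w01 by (intro mult_mono) auto
      then show "?w x * (1 + Re (z * iexp (?u x))) \<le> 2" by simp
    next
      fix s
      show "(CLINT x|M. of_real (?w x * (1 + Re (z * iexp (?u x)))) * iexp (s * x k))
        = (CLINT x|N. of_real (?w x * (1 + Re (z * iexp (?u x)))) * iexp (s * x k))"
        by (rule weight)
    qed (simp_all add: A)
    have int_box: "integrable L (\<lambda>x. (?w x * f x) * indicator (A k) (x k))"
      if "L = M \<or> L = N" "f \<in> borel_measurable (borel_pow p)" "\<And>x. \<bar>f x\<bar> \<le> (1::real)" for L f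
    proof -
      note [measurable] = that(2)
      have "\<bar>?w x * f x * indicator (A k) (x k)\<bar> \<le> 1" for x
        unfolding abs_mult using w01[of A "Suc k" x] that(3)[of x]
        by (intro mult_le_one) (auto split: split_indicator)
      then show ?thesis
        using that(1) by (auto intro!: M.integrable_const_bound[of _ 1] N.integrable_const_bound[of _ 1])
    qed
    have real_part: "(LINT x|M. (?w x * Re (z * iexp (?u x))) * indicator (A k) (x k))
        = (LINT x|N. (?w x * Re (z * iexp (?u x))) * indicator (A k) (x k))"
      if z: "norm z \<le> 1" for z
    proof -
      have "(LINT x|L. (?w x * (1 + Re (z * iexp (?u x)))) * indicator (A k) (x k))
        = (LINT x|L. (?w x * 1) * indicator (A k) (x k)) + (LINT x|L. (?w x * Re (z * iexp (?u x))) * indicator (A k) (x k))"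
        if "L = M \<or> L = N" for L
      proof -
        have "(LINT x|L. (?w x * (1 + Re (z * iexp (?u x)))) * indicator (A k) (x k))
          = (LINT x|L. (?w x * 1) * indicator (A k) (x k) + (?w x * Re (z * iexp (?u x))) * indicator (A k) (x k))"
          by (intro Bochner_Integration.integral_cong) (auto simp: algebra_simps)
        also have "\<dots> = (LINT x|L. (?w x * 1) * indicator (A k) (x k)) + (LINT x|L. (?w x * Re (z * iexp (?u x))) * indicator (A k) (x k))"
          using that Re_le[OF z] by (intro Bochner_Integration.integral_add int_box) auto
        finally show ?thesis .
      qed
      from this[of M] this[of N] shifted[OF z] shifted[of 0] show ?thesis by simp
    qed
    (* z = 1 and z = - i recover the real and the imaginary part of iexp u. *)
    have expand: "(CLINT x|L. of_real (w A k x) * iexp (u t k x))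
       = of_real (LINT x|L. (?w x * Re (1 * iexp (?u x))) * indicator (A k) (x k))
         + \<i> * of_real (LINT x|L. (?w x * Re (-\<i> * iexp (?u x))) * indicator (A k) (x k))"
      if "L = M \<or> L = N" for L
    proof -
      have i1: "integrable L (\<lambda>x. (?w x * Re (1 * iexp (?u x))) * indicator (A k) (x k))"
        using that by (intro int_box Re_le) auto
      have i2: "integrable L (\<lambda>x. (?w x * Re (-\<i> * iexp (?u x))) * indicator (A k) (x k))"
        using that by (intro int_box Re_le) auto
      have "(CLINT x|L. of_real (w A k x) * iexp (u t k x))
        = (CLINT x|L. of_real ((?w x * Re (1 * iexp (?u x))) * indicator (A k) (x k))
             + \<i> * of_real ((?w x * Re (-\<i> * iexp (?u x))) * indicator (A k) (x k)))"
        unfolding wk by (intro Bochner_Integration.integral_cong) (auto simp: complex_eq_iff)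
      also have "\<dots> = (CLINT x|L. of_real ((?w x * Re (1 * iexp (?u x))) * indicator (A k) (x k)))
        + \<i> * (CLINT x|L. of_real ((?w x * Re (-\<i> * iexp (?u x))) * indicator (A k) (x k)))"
        using i1 i2 by (subst Bochner_Integration.integral_add) (auto simp del: of_real_mult)
      finally show ?thesis
        by (simp only: integral_complex_of_real)
    qed
    show ?case
      using expand[of M] expand[of N] real_part[of 1] real_part[of "-\<i>"] by simp
  qed
  show ?thesis
  proof (rule measure_eqI_PiM_finite[of "{..<p}" M "\<lambda>_. borel" N "\<lambda>_. space (borel_pow p)"])
    fix A :: "nat \<Rightarrow> real set"
    assume A: "\<And>i. i \<in> {..<p} \<Longrightarrow> A i \<in> sets borel"
    define A' where "A' i = (if i < p then A i else {})" for i
    have A': "A' j \<in> sets borel" for j using A by (auto simp: A'_def)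
    have box: "Pi\<^sub>E {..<p} A \<in> sets (borel_pow p)" using A by (intro sets_PiM_I_finite) auto
    have ind: "w A' 0 x = indicator (Pi\<^sub>E {..<p} A) x" if "x \<in> space (borel_pow p)" for x
      using that by (auto simp: w_def A'_def space_PiM PiE_iff indicator_def lessThan_atLeast0 intro!: prod.neutral)
    have "measure L (Pi\<^sub>E {..<p} A) = Re (CLINT x|L. of_real (w A' 0 x) * iexp (u (\<lambda>_. 0) 0 x))"
      if "L = M \<or> L = N" for L
    proof -
      have sp: "space L = space (borel_pow p)" "Pi\<^sub>E {..<p} A \<in> sets L"
        using that sM sN box sets_eq_imp_space_eq[OF sM] sets_eq_imp_space_eq[OF sN] by auto
      have "(CLINT x|L. of_real (w A' 0 x) * iexp (u (\<lambda>_. 0) 0 x))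
        = (CLINT x|L. of_real (indicator (Pi\<^sub>E {..<p} A) x))"
        using ind sp by (intro Bochner_Integration.integral_cong) (auto simp: u_def)
      then show ?thesis
        using sp(2) sets.sets_into_space[OF sp(2)]
        by (simp add: integral_complex_of_real Int_absorb2)
    qed
    then have "measure M (Pi\<^sub>E {..<p} A) = measure N (Pi\<^sub>E {..<p} A)"
      using boxes[OF _ A', of 0] by simp
    then show "emeasure M (Pi\<^sub>E {..<p} A) = emeasure N (Pi\<^sub>E {..<p} A)"
      by (simp add: M.emeasure_eq_measure N.emeasure_eq_measure)
  next
    show "range (\<lambda>_::nat. space (borel_pow p)) \<subseteq> prod_algebra {..<p} (\<lambda>_. borel)"
      by (auto intro!: prod_algebraI_finite simp: space_PiM)
  qed (use sM sN in auto)
qed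

abbreviation std_gauss :: "nat \<Rightarrow> (nat \<Rightarrow> real) measure" where
  "std_gauss p \<equiv> Pi\<^sub>M {..<p} (\<lambda>_. density lborel std_normal_density)"

lemma prob_space_std_gauss: "prob_space (std_gauss p)"
  by (intro prob_space_PiM prob_space_normal_density) auto

lemma sets_std_gauss [measurable_cong]: "sets (std_gauss p) = sets (borel_pow p)"
  by (intro sets_PiM_cong) auto

lemma charfun_std_gauss:
  "(CLINT z|std_gauss p. iexp (\<Sum>j<p. s j * z j)) = of_real (exp (- (\<Sum>j<p. (s j)\<^sup>2) / 2))"
proof -
  interpret S: prob_space "density lborel (\<lambda>x. ennreal (std_normal_density x))"
    by (rule prob_space_normal_density) auto
  interpret product_sigma_finite "\<lambda>_::nat. density lborel (\<lambda>x. ennreal (std_normal_density x))"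
    by standard
  have "(CLINT z|std_gauss p. iexp (\<Sum>j<p. s j * z j)) = (CLINT z|std_gauss p. (\<Prod>j<p. iexp (s j * z j)))"
    by (simp add: sum_distrib_left exp_sum)
  also have "\<dots> = (\<Prod>j<p. CLINT x|std_normal_distribution. iexp (s j * x))"
    by (subst product_integral_prod) (auto intro!: S.integrable_iexp)
  also have "\<dots> = (\<Prod>j<p. of_real (exp (- (s j)\<^sup>2 / 2)))"
    using char_std_normal_distribution by (simp add: char_def fun_eq_iff)
  also have "\<dots> = of_real (exp (- (\<Sum>j<p. (s j)\<^sup>2) / 2))"
    by (simp add: exp_sum[symmetric] sum_divide_distrib sum_negf del: of_real_exp flip: of_real_prod)
  finally show ?thesis .
qed

text \<open>
  The characteristic function of \<open>A Z\<close> at \<open>t\<close> is \<open>exp (- t\<^sup>T A A\<^sup>T t / 2)\<close>, which sees \<open>A\<close> only through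
  \<open>A A\<^sup>T\<close>.
\<close>
lemma gauss_image_cong:
  assumes A: "A \<in> carrier_mat p p" and B: "B \<in> carrier_mat p p"
    and eq: "A * transpose_mat A = B * transpose_mat B"
  shows "distr (std_gauss p) (borel_pow p) (linear_image p A) = distr (std_gauss p) (borel_pow p) (linear_image p B)"
proof (rule charfun_determines_law_PiM)
  fix t :: "nat \<Rightarrow> real"
  have cf: "(CLINT x|distr (std_gauss p) (borel_pow p) (linear_image p A). iexp (\<Sum>j<p. t j * x j))
     = of_real (exp (- (\<Sum>i<p. \<Sum>k<p. t i * t k * (A * transpose_mat A) $$ (i, k)) / 2))"
    if A: "A \<in> carrier_mat p p" for A
  proof -
    have "(CLINT x|distr (std_gauss p) (borel_pow p) (linear_image p A). iexp (\<Sum>j<p. t j * x j))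
      = (CLINT z|std_gauss p. iexp (\<Sum>j<p. t j * linear_image p A z j))"
      by (subst integral_distr[OF measurable_linear_image]) auto
    also have "\<dots> = (CLINT z|std_gauss p. iexp (\<Sum>j<p. (\<Sum>i<p. t i * A $$ (i, j)) * z j))"
    proof (intro Bochner_Integration.integral_cong refl)
      fix z :: "nat \<Rightarrow> real"
      have "(\<Sum>i<p. t i * linear_image p A z i) = (\<Sum>i<p. \<Sum>j<p. t i * A $$ (i, j) * z j)"
        by (simp add: linear_image_def sum_distrib_left mult_ac)
      also have "\<dots> = (\<Sum>j<p. \<Sum>i<p. t i * A $$ (i, j) * z j)" by (rule sum.swap)
      finally show "iexp (\<Sum>j<p. t j * linear_image p A z j) = iexp (\<Sum>j<p. (\<Sum>i<p. t i * A $$ (i, j)) * z j)"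
        by (simp add: sum_distrib_right)
    qed
    also have "\<dots> = of_real (exp (- (\<Sum>j<p. (\<Sum>i<p. t i * A $$ (i, j))\<^sup>2) / 2))"
      by (rule charfun_std_gauss)
    also have "(\<Sum>j<p. (\<Sum>i<p. t i * A $$ (i, j))\<^sup>2) = (\<Sum>i<p. \<Sum>k<p. t i * t k * (A * transpose_mat A) $$ (i, k))"
    proof -
      have "(\<Sum>j<p. (\<Sum>i<p. t i * A $$ (i, j))\<^sup>2) = (\<Sum>j<p. \<Sum>i<p. \<Sum>k<p. t i * t k * (A $$ (i, j) * A $$ (k, j)))"
        by (simp add: power2_eq_square sum_product mult_ac)
      also have "\<dots> = (\<Sum>i<p. \<Sum>j<p. \<Sum>k<p. t i * t k * (A $$ (i, j) * A $$ (k, j)))"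
        by (rule sum.swap)
      also have "\<dots> = (\<Sum>i<p. \<Sum>k<p. \<Sum>j<p. t i * t k * (A $$ (i, j) * A $$ (k, j)))"
        by (intro sum.cong refl sum.swap)
      also have "\<dots> = (\<Sum>i<p. \<Sum>k<p. t i * t k * (A * transpose_mat A) $$ (i, k))"
        using A by (auto simp: scalar_prod_def sum_distrib_left lessThan_atLeast0 intro!: sum.cong)
      finally show ?thesis .
    qed
    finally show ?thesis .
  qed
  show "(CLINT x|distr (std_gauss p) (borel_pow p) (linear_image p A). iexp (\<Sum>j<p. t j * x j))
    = (CLINT x|distr (std_gauss p) (borel_pow p) (linear_image p B). iexp (\<Sum>j<p. t j * x j))"
    unfolding cf[OF A] cf[OF B] eq ..
qed (auto intro!: prob_space.prob_space_distr prob_space_std_gauss measurable_linear_image)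

text \<open>
  The normal law is defined through an unspecified square root of the covariance matrix; this lemma
  replaces it by any square root that is convenient to compute with.
\<close>
lemma mvn_gram:
  assumes "B \<in> carrier_mat p p"
  shows "mvn p (B * transpose_mat B) = distr (std_gauss p) (borel_pow p) (linear_image p B)"
proof -
  have "\<exists>A. A \<in> carrier_mat p p \<and> A * transpose_mat A = B * transpose_mat B"
    using assms by blast
  from someI_ex[OF this] show ?thesis
    unfolding mvn_def using assms by (intro gauss_image_cong) auto
qed

section \<open>The operator norm and the covariance class\<close>

lemma scalar_prod_eq_sum:
  assumes "w \<in> carrier_vec p"
  shows "scalar_prod v w = (\<Sum>i<p. v $ i * w $ i)"
  using assms by (auto simp: scalar_prod_def lessThan_atLeast0)

lemma vec_l2norm_sq: "(vec_l2norm v)\<^sup>2 = scalar_prod v v"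
  unfolding vec_l2norm_def by (intro real_sqrt_pow2) (auto simp: scalar_prod_def intro!: sum_nonneg)

lemma vec_l2norm_sq_eq_sum:
  assumes "w \<in> carrier_vec p"
  shows "(vec_l2norm w)\<^sup>2 = (\<Sum>j<p. (w $ j)\<^sup>2)"
  unfolding vec_l2norm_sq scalar_prod_eq_sum[OF assms] by (simp add: power2_eq_square)

lemma vec_l2norm_nonneg: "0 \<le> vec_l2norm v"
  unfolding vec_l2norm_def by (auto simp: scalar_prod_def intro!: sum_nonneg)

lemma vec_l2norm_smult: "vec_l2norm (c \<cdot>\<^sub>v v) = \<bar>c\<bar> * vec_l2norm v"
proof -
  have "scalar_prod (c \<cdot>\<^sub>v v) (c \<cdot>\<^sub>v v) = c\<^sup>2 * scalar_prod v v"
    by (simp add: power2_eq_square mult_ac)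
  then show ?thesis unfolding vec_l2norm_def by (simp add: real_sqrt_mult)
qed

lemma vec_l2norm_eq_0D:
  assumes "v \<in> carrier_vec p" "vec_l2norm v = 0"
  shows "v = 0\<^sub>v p"
proof -
  have "(\<Sum>i<p. v $ i * v $ i) = 0"
    using assms vec_l2norm_sq[of v] by (simp add: scalar_prod_eq_sum)
  then have "\<forall>i<p. v $ i = 0"
    by (subst (asm) sum_nonneg_eq_0_iff) auto
  then show ?thesis using assms(1) by (intro eq_vecI) auto
qed

lemma mult_mat_vec_nth:
  assumes "A \<in> carrier_mat p p" "v \<in> carrier_vec p" "i < p"
  shows "(A *\<^sub>v v) $ i = (\<Sum>j<p. A $$ (i, j) * v $ j)"
  using assms by (auto simp: scalar_prod_def lessThan_atLeast0 intro!: sum.cong)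

lemma gram_nth:
  assumes "B \<in> carrier_mat p p" "i < p" "j < p"
  shows "(B * transpose_mat B) $$ (i, j) = (\<Sum>k<p. B $$ (i, k) * B $$ (j, k))"
  using assms by (auto simp: scalar_prod_def lessThan_atLeast0 intro!: sum.cong)

lemma mult_mat_vec_bounded:
  assumes "A \<in> carrier_mat p p" "v \<in> carrier_vec p"
  shows "(vec_l2norm (A *\<^sub>v v))\<^sup>2 \<le> (\<Sum>i<p. \<Sum>j<p. (A $$ (i, j))\<^sup>2) * (vec_l2norm v)\<^sup>2"
proof -
  have Av: "A *\<^sub>v v \<in> carrier_vec p" using assms by (rule mult_mat_vec_carrier)
  have "(vec_l2norm (A *\<^sub>v v))\<^sup>2 = (\<Sum>i<p. (\<Sum>j<p. A $$ (i, j) * v $ j)\<^sup>2)"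
    unfolding vec_l2norm_sq_eq_sum[OF Av] by (intro sum.cong refl) (simp only: mult_mat_vec_nth[OF assms] lessThan_iff)
  also have "\<dots> \<le> (\<Sum>i<p. (\<Sum>j<p. (A $$ (i, j))\<^sup>2) * (\<Sum>j<p. (v $ j)\<^sup>2))"
    by (intro sum_mono Cauchy_Schwarz_ineq_sum)
  also have "\<dots> = (\<Sum>i<p. \<Sum>j<p. (A $$ (i, j))\<^sup>2) * (vec_l2norm v)\<^sup>2"
    unfolding vec_l2norm_sq_eq_sum[OF assms(2)] by (simp only: sum_distrib_right[symmetric])
  finally show ?thesis .
qed

lemma op_norm_bdd_above:
  assumes "A \<in> carrier_mat p p"
  shows "bdd_above ((\<lambda>v. vec_l2norm (A *\<^sub>v v)) ` {v \<in> carrier_vec (dim_col A). vec_l2norm v \<le> 1})"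
proof (rule bdd_aboveI2)
  fix v assume v: "v \<in> {v \<in> carrier_vec (dim_col A). vec_l2norm v \<le> 1}"
  let ?F = "\<Sum>i<p. \<Sum>j<p. (A $$ (i, j))\<^sup>2"
  have "(vec_l2norm (A *\<^sub>v v))\<^sup>2 \<le> ?F * (vec_l2norm v)\<^sup>2"
    using v assms by (intro mult_mat_vec_bounded) auto
  also have "\<dots> \<le> ?F * 1"
    using v by (intro mult_left_mono) (auto simp: power_le_one vec_l2norm_nonneg intro!: sum_nonneg)
  finally show "vec_l2norm (A *\<^sub>v v) \<le> sqrt ?F"
    by (intro real_le_rsqrt) simp
qed

lemma op_norm_upper:
  assumes "A \<in> carrier_mat p p" "v \<in> carrier_vec p" "vec_l2norm v \<le> 1"
  shows "vec_l2norm (A *\<^sub>v v) \<le> op_norm A"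
  unfolding op_norm_def using assms by (intro cSUP_upper op_norm_bdd_above) auto

lemma op_norm_nonneg:
  assumes "A \<in> carrier_mat p p"
  shows "0 \<le> op_norm A"
  using op_norm_upper[OF assms, of "0\<^sub>v p"] vec_l2norm_nonneg[of "A *\<^sub>v 0\<^sub>v p"]
  by (simp add: vec_l2norm_def[of "0\<^sub>v p"])

lemma op_norm_le_iff:
  assumes A: "A \<in> carrier_mat p p" and t: "0 \<le> t"
  shows "op_norm A \<le> t \<longleftrightarrow> (\<forall>v \<in> carrier_vec p. (vec_l2norm (A *\<^sub>v v))\<^sup>2 \<le> t\<^sup>2 * (vec_l2norm v)\<^sup>2)"
proof
  assume le: "op_norm A \<le> t"
  show "\<forall>v \<in> carrier_vec p. (vec_l2norm (A *\<^sub>v v))\<^sup>2 \<le> t\<^sup>2 * (vec_l2norm v)\<^sup>2"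
  proof
    fix v :: "real vec" assume v: "v \<in> carrier_vec p"
    show "(vec_l2norm (A *\<^sub>v v))\<^sup>2 \<le> t\<^sup>2 * (vec_l2norm v)\<^sup>2"
    proof (cases "vec_l2norm v = 0")
      case True
      then show ?thesis using mult_mat_vec_bounded[OF A v] by simp
    next
      case False
      define r where "r = vec_l2norm v"
      have r: "r > 0" using False vec_l2norm_nonneg[of v] by (simp add: r_def)
      have "vec_l2norm (A *\<^sub>v ((1 / r) \<cdot>\<^sub>v v)) \<le> op_norm A"
        using v r by (intro op_norm_upper[OF A]) (auto simp: vec_l2norm_smult r_def[symmetric])
      then have "1 / r * vec_l2norm (A *\<^sub>v v) \<le> t"
        unfolding mult_mat_vec[OF A v] using le r by (simp add: vec_l2norm_smult)
      then have "vec_l2norm (A *\<^sub>v v) \<le> t * r"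
        using r by (simp add: pos_divide_le_eq)
      then have "(vec_l2norm (A *\<^sub>v v))\<^sup>2 \<le> (t * r)\<^sup>2"
        by (intro power_mono vec_l2norm_nonneg)
      then show ?thesis by (simp add: r_def power_mult_distrib)
    qed
  qed
next
  assume all: "\<forall>v \<in> carrier_vec p. (vec_l2norm (A *\<^sub>v v))\<^sup>2 \<le> t\<^sup>2 * (vec_l2norm v)\<^sup>2"
  show "op_norm A \<le> t"
    unfolding op_norm_def
  proof (rule cSUP_least)
    have "0\<^sub>v p \<in> {v \<in> carrier_vec (dim_col A). vec_l2norm v \<le> 1}"
      using A by (simp add: vec_l2norm_def)
    then show "{v \<in> carrier_vec (dim_col A). vec_l2norm v \<le> 1} \<noteq> {}" by (metis empty_iff)
  next
    fix v assume "v \<in> {v \<in> carrier_vec (dim_col A). vec_l2norm v \<le> 1}"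
    then have v: "v \<in> carrier_vec p" "vec_l2norm v \<le> 1" using A by auto
    have "(vec_l2norm (A *\<^sub>v v))\<^sup>2 \<le> t\<^sup>2 * (vec_l2norm v)\<^sup>2" using all v(1) by (rule bspec)
    also have "\<dots> \<le> t\<^sup>2 * 1"
      using v(2) by (intro mult_left_mono power_le_one vec_l2norm_nonneg) simp_all
    finally have "(vec_l2norm (A *\<^sub>v v))\<^sup>2 \<le> t\<^sup>2" by (simp only: mult_1_right)
    then show "vec_l2norm (A *\<^sub>v v) \<le> t" using t by (rule power2_le_imp_le)
  qed
qed

text \<open>
  Testing the matrix on its own (truncated) row gives the bound. It turns the operator-norm loss into
  a sum over coordinates, which is the form that Assouad's method needs.
\<close>
lemma row_norm_le_op_norm:
  assumes A: "A \<in> carrier_mat p p" and i: "i < p" and J: "J \<subseteq> {..<p}"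
  shows "(\<Sum>j\<in>J. (A $$ (i, j))\<^sup>2) \<le> (op_norm A)\<^sup>2"
proof -
  define R where "R = (\<Sum>j\<in>J. (A $$ (i, j))\<^sup>2)"
  define v where "v = vec p (\<lambda>j. if j \<in> J then A $$ (i, j) else 0)"
  have v: "v \<in> carrier_vec p" by (simp add: v_def)
  have R0: "R \<ge> 0" unfolding R_def by (intro sum_nonneg) auto
  have "(\<Sum>j<p. (v $ j)\<^sup>2) = (\<Sum>j<p. if j \<in> J then (A $$ (i, j))\<^sup>2 else 0)"
    by (intro sum.cong) (auto simp: v_def)
  then have nv: "(vec_l2norm v)\<^sup>2 = R"
    using J by (simp add: vec_l2norm_sq_eq_sum[OF v] R_def sum.If_cases Int_absorb1)
  have "(A *\<^sub>v v) $ i = (\<Sum>j<p. if j \<in> J then (A $$ (i, j))\<^sup>2 else 0)"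
    unfolding mult_mat_vec_nth[OF A v i] by (intro sum.cong) (auto simp: v_def power2_eq_square)
  then have Av: "(A *\<^sub>v v) $ i = R"
    using J by (simp add: R_def sum.If_cases Int_absorb1)
  have "R * R = ((A *\<^sub>v v) $ i)\<^sup>2" using Av by (simp only: power2_eq_square)
  also have "\<dots> \<le> (\<Sum>k<p. ((A *\<^sub>v v) $ k)\<^sup>2)"
    using i by (intro member_le_sum) auto
  also have "\<dots> = (vec_l2norm (A *\<^sub>v v))\<^sup>2"
    by (rule vec_l2norm_sq_eq_sum[OF mult_mat_vec_carrier[OF A v], symmetric])
  also have "\<dots> \<le> (op_norm A)\<^sup>2 * R"
    using op_norm_le_iff[OF A op_norm_nonneg[OF A]] v nv by auto
  finally have "R * R \<le> (op_norm A)\<^sup>2 * R" .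
  then show ?thesis
    using R0 unfolding R_def[symmetric] by (cases "R = 0") (auto simp: mult_le_cancel_right)
qed

text \<open>
  Both sides of the inequality are continuous in the vector, so rational vectors suffice. The scale-free
  form avoids having to approximate inside the unit ball.
\<close>
lemma op_norm_le_iff_rational:
  assumes A: "A \<in> carrier_mat p p" and t: "0 \<le> t"
  shows "op_norm A \<le> t \<longleftrightarrow> (\<forall>q \<in> Pi\<^sub>E {..<p} (\<lambda>_. \<rat>).
    (\<Sum>i<p. (\<Sum>j<p. A $$ (i, j) * q j)\<^sup>2) \<le> t\<^sup>2 * (\<Sum>j<p. (q j)\<^sup>2))"
proof -
  have norms: "(vec_l2norm (A *\<^sub>v v))\<^sup>2 = (\<Sum>i<p. (\<Sum>j<p. A $$ (i, j) * v $ j)\<^sup>2)"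
    "(vec_l2norm v)\<^sup>2 = (\<Sum>j<p. (v $ j)\<^sup>2)" if v: "v \<in> carrier_vec p" for v
    unfolding vec_l2norm_sq_eq_sum[OF v] vec_l2norm_sq_eq_sum[OF mult_mat_vec_carrier[OF A v]]
    by (rule sum.cong[OF refl], simp only: mult_mat_vec_nth[OF A v] lessThan_iff) (rule refl)
  show ?thesis
  proof
    assume "op_norm A \<le> t"
    then have *: "(vec_l2norm (A *\<^sub>v v))\<^sup>2 \<le> t\<^sup>2 * (vec_l2norm v)\<^sup>2" if "v \<in> carrier_vec p" for v
      using op_norm_le_iff[OF A t] that by auto
    show "\<forall>q \<in> Pi\<^sub>E {..<p} (\<lambda>_. \<rat>).
      (\<Sum>i<p. (\<Sum>j<p. A $$ (i, j) * q j)\<^sup>2) \<le> t\<^sup>2 * (\<Sum>j<p. (q j)\<^sup>2)"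
    proof
      fix q :: "nat \<Rightarrow> real"
      show "(\<Sum>i<p. (\<Sum>j<p. A $$ (i, j) * q j)\<^sup>2) \<le> t\<^sup>2 * (\<Sum>j<p. (q j)\<^sup>2)"
        using *[of "vec p q"] by (simp add: norms)
    qed
  next
    assume rat: "\<forall>q \<in> Pi\<^sub>E {..<p} (\<lambda>_. \<rat>).
      (\<Sum>i<p. (\<Sum>j<p. A $$ (i, j) * q j)\<^sup>2) \<le> t\<^sup>2 * (\<Sum>j<p. (q j)\<^sup>2)"
    show "op_norm A \<le> t"
      unfolding op_norm_le_iff[OF A t]
    proof
      fix v :: "real vec" assume v: "v \<in> carrier_vec p"
      have "\<exists>q. (\<forall>n. q n \<in> \<rat>) \<and> q \<longlonglongrightarrow> v $ j" for j
      proof -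
        have "v $ j \<in> closure \<rat>" by (simp add: Rats_closure_real)
        then show ?thesis unfolding closure_sequential by blast
      qed
      then obtain q where q: "\<And>j n. q j n \<in> \<rat>" "\<And>j. q j \<longlonglongrightarrow> v $ j" by metis
      have lhs: "(\<lambda>n. \<Sum>i<p. (\<Sum>j<p. A $$ (i, j) * q j n)\<^sup>2) \<longlonglongrightarrow> (\<Sum>i<p. (\<Sum>j<p. A $$ (i, j) * v $ j)\<^sup>2)"
        by (intro tendsto_intros q)
      have rhs: "(\<lambda>n. t\<^sup>2 * (\<Sum>j<p. (q j n)\<^sup>2)) \<longlonglongrightarrow> t\<^sup>2 * (\<Sum>j<p. (v $ j)\<^sup>2)"
        by (intro tendsto_intros q)
      have le: "(\<Sum>i<p. (\<Sum>j<p. A $$ (i, j) * q j n)\<^sup>2) \<le> t\<^sup>2 * (\<Sum>j<p. (q j n)\<^sup>2)" for n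
        using bspec[OF rat, of "\<lambda>j\<in>{..<p}. q j n"] q(1) by simp
      have "(\<Sum>i<p. (\<Sum>j<p. A $$ (i, j) * v $ j)\<^sup>2) \<le> t\<^sup>2 * (\<Sum>j<p. (v $ j)\<^sup>2)"
        using LIMSEQ_le[OF lhs rhs] le by blast
      then show "(vec_l2norm (A *\<^sub>v v))\<^sup>2 \<le> t\<^sup>2 * (vec_l2norm v)\<^sup>2"
        using norms[OF v] by simp
    qed
  qed
qed

text \<open>
  The error event has to be measurable, since the \<^const>\<open>emeasure\<close> of a non-measurable set is \<open>0\<close> and a
  lower bound on it would fail. Sublevel sets of the norm are countable intersections by the preceding
  lemma.
\<close>
lemma borel_measurable_op_norm:
  assumes carrier: "\<And>x. x \<in> space M \<Longrightarrow> S x \<in> carrier_mat p p"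
    and meas: "\<And>i j. i < p \<Longrightarrow> j < p \<Longrightarrow> (\<lambda>x. S x $$ (i, j)) \<in> borel_measurable M"
  shows "(\<lambda>x. op_norm (S x)) \<in> borel_measurable M"
  unfolding borel_measurable_iff_le
proof
  fix t :: real
  show "{x \<in> space M. op_norm (S x) \<le> t} \<in> sets M"
  proof (cases "t < 0")
    case True
    then have "\<not> op_norm (S x) \<le> t" if "x \<in> space M" for x
      using op_norm_nonneg[OF carrier[OF that]] by simp
    then have "{x \<in> space M. op_norm (S x) \<le> t} = {}" by blast
    then show ?thesis by (simp only: sets.empty_sets)
  next
    case False
    let ?Q = "Pi\<^sub>E {..<p} (\<lambda>_. \<rat> :: real set)"
    let ?P = "\<lambda>q x. (\<Sum>i<p. (\<Sum>j<p. S x $$ (i, j) * q j)\<^sup>2) \<le> t\<^sup>2 * (\<Sum>j<p. (q j)\<^sup>2)"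
    have "countable ?Q"
      by (intro countable_PiE) (auto simp: countable_rat)
    moreover have ne: "?Q \<noteq> {}" by (simp add: PiE_eq_empty_iff) (use Rats_0 in blast)
    moreover have "{x \<in> space M. ?P q x} \<in> sets M" for q
    proof -
      have "(\<lambda>x. \<Sum>i<p. (\<Sum>j<p. S x $$ (i, j) * q j)\<^sup>2) \<in> borel_measurable M"
        by (intro borel_measurable_sum borel_measurable_power borel_measurable_times borel_measurable_const meas) auto
      then show ?thesis
        unfolding borel_measurable_iff_le by blast
    qed
    ultimately have "(\<Inter>q\<in>?Q. {x \<in> space M. ?P q x}) \<in> sets M"
      by (intro sets.countable_INT') auto
    also have "(\<Inter>q\<in>?Q. {x \<in> space M. ?P q x}) = {x \<in> space M. \<forall>q\<in>?Q. ?P q x}"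
      using ne by blast
    finally have "{x \<in> space M. \<forall>q\<in>?Q. ?P q x} \<in> sets M" .
    moreover have "op_norm (S x) \<le> t \<longleftrightarrow> (\<forall>q \<in> Pi\<^sub>E {..<p} (\<lambda>_. \<rat>).
      (\<Sum>i<p. (\<Sum>j<p. S x $$ (i, j) * q j)\<^sup>2) \<le> t\<^sup>2 * (\<Sum>j<p. (q j)\<^sup>2))" if "x \<in> space M" for x
      using False by (intro op_norm_le_iff_rational carrier that) simp
    ultimately show ?thesis
      by (simp cong: conj_cong)
  qed
qed

text \<open>
  Without a real eigenvalue, \<^const>\<open>s_max\<close> would be the maximum of the empty set. A complex eigenvalue
  exists, and it is real because \<open>v\<^sup>* S v\<close> is real.
\<close>
lemma real_symmetric_spectrum_nonempty:
  fixes S :: "real mat"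
  assumes S: "S \<in> carrier_mat p p" and sym: "transpose_mat S = S" and p: "0 < p"
  shows "spectrum S \<noteq> {}"
proof -
  let ?C = "map_mat complex_of_real S"
  have C: "?C \<in> carrier_mat p p" using S by simp
  have "spectrum ?C \<noteq> {}" using spectrum_non_empty[OF C] p by simp
  then obtain k where k: "eigenvalue ?C k" unfolding spectrum_def by auto
  then obtain v where v: "v \<in> carrier_vec p" "v \<noteq> 0\<^sub>v p" and eig: "?C *\<^sub>v v = k \<cdot>\<^sub>v v"
    using S unfolding eigenvalue_def eigenvector_def by auto
  have nth: "k * v $ i = (\<Sum>j<p. of_real (S $$ (i, j)) * v $ j)" if "i < p" for i
  proof -
    have "k * v $ i = (?C *\<^sub>v v) $ i" using eig v that by simp
    also have "\<dots> = (\<Sum>j<p. of_real (S $$ (i, j)) * v $ j)"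
      using S v that by (auto simp: scalar_prod_def lessThan_atLeast0 intro!: sum.cong)
    finally show ?thesis .
  qed
  have symij: "S $$ (i, j) = S $$ (j, i)" if "i < p" "j < p" for i j
    using sym S that by (metis carrier_matD index_transpose_mat(1))
  define N where "N = (\<Sum>i<p. v $ i * cnj (v $ i))"
  have kN: "k * N = (\<Sum>i<p. \<Sum>j<p. of_real (S $$ (i, j)) * v $ j * cnj (v $ i))"
    unfolding N_def sum_distrib_left by (intro sum.cong) (simp_all add: mult.assoc[symmetric] nth sum_distrib_right)
  have "cnj k * N = (\<Sum>i<p. v $ i * cnj (k * v $ i))"
    unfolding N_def sum_distrib_left by (intro sum.cong) simp_all
  also have "\<dots> = (\<Sum>i<p. \<Sum>j<p. of_real (S $$ (i, j)) * v $ i * cnj (v $ j))"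
    by (intro sum.cong) (simp_all add: nth sum_distrib_left mult_ac)
  also have "\<dots> = (\<Sum>j<p. \<Sum>i<p. of_real (S $$ (i, j)) * v $ i * cnj (v $ j))"
    by (rule sum.swap)
  also have "\<dots> = k * N" unfolding kN by (intro sum.cong refl) (simp add: symij)
  finally have "(cnj k - k) * N = 0" by (simp add: algebra_simps)
  moreover have "N \<noteq> 0"
  proof
    assume "N = 0"
    then have "(\<Sum>i<p. (cmod (v $ i))\<^sup>2) = 0"
      unfolding N_def complex_norm_square[symmetric] of_real_power[symmetric] of_real_sum[symmetric]
      by (simp only: of_real_eq_0_iff)
    then have "\<forall>i<p. v $ i = 0" by (subst (asm) sum_nonneg_eq_0_iff) auto
    then show False using v by auto
  qed
  ultimately have "cnj k = k" by simp
  then have kr: "k = of_real (Re k)" by (simp add: complex_eq_iff)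
  have "poly (char_poly ?C) k = 0" using k eigenvalue_root_char_poly[OF C] by simp
  then have "of_real (poly (char_poly S) (Re k)) = (0 :: complex)"
    using kr by (metis S of_real_hom.char_poly_hom of_real_hom.poly_map_poly)
  then have "eigenvalue S (Re k)" using eigenvalue_root_char_poly[OF S] by simp
  then show ?thesis unfolding spectrum_def by auto
qed

text \<open>
  An eigenvector \<open>v\<close> of \<open>\<Sigma>\<^sup>T \<Sigma>\<close> for \<open>k\<close> has \<open>k \<parallel>v\<parallel>\<^sup>2 = \<parallel>\<Sigma> v\<parallel>\<^sup>2\<close>, and with \<open>\<Sigma> = B B\<^sup>T\<close> the bound \<open>\<parallel>B\<parallel>\<^sup>2 \<le> M\<close> is
  applied once to \<open>B\<close> and once, by duality, to \<open>B\<^sup>T\<close>.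
\<close>
lemma gram_in_cov_class:
  assumes B: "B \<in> carrier_mat p p" and p: "0 < p" and M: "0 \<le> M"
    and bound: "\<And>v. v \<in> carrier_vec p \<Longrightarrow> (vec_l2norm (B *\<^sub>v v))\<^sup>2 \<le> M * (vec_l2norm v)\<^sup>2"
  shows "B * transpose_mat B \<in> cov_class p M"
proof -
  let ?S = "B * transpose_mat B" and ?T = "transpose_mat B"
  have T: "?T \<in> carrier_mat p p" and S: "?S \<in> carrier_mat p p" using B by auto
  have symS: "transpose_mat ?S = ?S" using B by (simp add: transpose_mult[of _ p p _ p])
  have adj: "scalar_prod v (?S *\<^sub>v v) = (vec_l2norm (?T *\<^sub>v v))\<^sup>2" if v: "v \<in> carrier_vec p" for v
  proof -
    have "scalar_prod v (?S *\<^sub>v v) = scalar_prod v (B *\<^sub>v (?T *\<^sub>v v))"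
      using B T v by (simp add: assoc_mult_mat_vec[of _ p p _ p])
    also have "\<dots> = scalar_prod (?T *\<^sub>v v) (?T *\<^sub>v v)"
      using transpose_vec_mult_scalar[OF B, of "?T *\<^sub>v v" v] B v T by simp
    finally show ?thesis by (simp add: vec_l2norm_sq)
  qed
  have psd: "pos_semidef p ?S" unfolding pos_semidef_def using adj by simp
  have "s_max ?S \<le> M"
    unfolding s_max_def
  proof (rule Max.boundedI)
    let ?Q = "transpose_mat ?S * ?S"
    have Q: "?Q \<in> carrier_mat p p" using S by simp
    have "spectrum ?Q \<noteq> {}"
    proof (rule real_symmetric_spectrum_nonempty[OF Q _ p])
      show "transpose_mat ?Q = ?Q" using S by (simp add: transpose_mult[of _ p p _ p])
    qed
    then show "singular_values ?S \<noteq> {}" by (simp add: singular_values_def)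
    show "finite (singular_values ?S)"
      unfolding singular_values_def using card_finite_spectrum(1)[OF Q] by simp
    fix s assume "s \<in> singular_values ?S"
    then obtain k where k: "s = sqrt k" "eigenvalue ?Q k"
      unfolding singular_values_def spectrum_def by auto
    then obtain v where v: "v \<in> carrier_vec p" "v \<noteq> 0\<^sub>v p" and eig: "?Q *\<^sub>v v = k \<cdot>\<^sub>v v"
      using Q unfolding eigenvalue_def eigenvector_def by auto
    have nv: "vec_l2norm v > 0"
      using vec_l2norm_eq_0D[OF v(1)] v(2) vec_l2norm_nonneg[of v] by fastforce
    have contr: "(vec_l2norm (?T *\<^sub>v w))\<^sup>2 \<le> M * (vec_l2norm w)\<^sup>2" if w: "w \<in> carrier_vec p" for w
    proof -
      let ?a = "vec_l2norm (?T *\<^sub>v w)" and ?b = "vec_l2norm w"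
      have BT: "?S *\<^sub>v w = B *\<^sub>v (?T *\<^sub>v w)" using B T w by (simp add: assoc_mult_mat_vec[of _ p p _ p])
      have Tw: "?T *\<^sub>v w \<in> carrier_vec p" using T w by simp
      have CS: "(scalar_prod w u)\<^sup>2 \<le> (vec_l2norm w)\<^sup>2 * (vec_l2norm u)\<^sup>2" if "u \<in> carrier_vec p" for u
        unfolding scalar_prod_eq_sum[OF that] vec_l2norm_sq_eq_sum[OF w] vec_l2norm_sq_eq_sum[OF that]
        by (rule Cauchy_Schwarz_ineq_sum)
      have "(?a\<^sup>2)\<^sup>2 = (scalar_prod w (?S *\<^sub>v w))\<^sup>2" using adj[OF w] by simp
      also have "\<dots> \<le> ?b\<^sup>2 * (vec_l2norm (?S *\<^sub>v w))\<^sup>2" using CS S w by simp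
      also have "\<dots> \<le> ?b\<^sup>2 * (M * ?a\<^sup>2)"
        unfolding BT by (intro mult_left_mono bound Tw) simp
      finally have "?a\<^sup>2 * ?a\<^sup>2 \<le> (M * ?b\<^sup>2) * ?a\<^sup>2" by (simp add: power2_eq_square mult_ac)
      moreover have "0 \<le> M * ?b\<^sup>2" using M by simp
      ultimately show ?thesis
        using mult_le_cancel_right[of "?a\<^sup>2" "?a\<^sup>2" "M * ?b\<^sup>2"] by (cases "?a = 0") auto
    qed
    have "k * (vec_l2norm v)\<^sup>2 = scalar_prod v (k \<cdot>\<^sub>v v)"
      using v by (simp add: vec_l2norm_sq)
    also have "\<dots> = scalar_prod v (?Q *\<^sub>v v)" using eig by simp
    also have "\<dots> = scalar_prod v (?S *\<^sub>v (?S *\<^sub>v v))"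
      using S v by (simp only: symS assoc_mult_mat_vec)
    also have "\<dots> = (vec_l2norm (?S *\<^sub>v v))\<^sup>2"
      using transpose_vec_mult_scalar[OF S, of "?S *\<^sub>v v" v] S v by (simp only: symS vec_l2norm_sq mult_mat_vec_carrier)
    also have "?S *\<^sub>v v = B *\<^sub>v (?T *\<^sub>v v)" using B T v by (simp add: assoc_mult_mat_vec[of _ p p _ p])
    also have "(vec_l2norm (B *\<^sub>v (?T *\<^sub>v v)))\<^sup>2 \<le> M * (vec_l2norm (?T *\<^sub>v v))\<^sup>2"
      using T v by (intro bound) simp
    also have "\<dots> \<le> M * (M * (vec_l2norm v)\<^sup>2)"
      using M v by (intro mult_left_mono contr)
    finally have "k \<le> M\<^sup>2" using nv by (simp add: power2_eq_square)
    then show "s \<le> M" unfolding k(1) using M real_sqrt_le_mono[of k "M\<^sup>2"] by simp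
  qed
  then show ?thesis unfolding cov_class_def using S symS psd by simp
qed

section \<open>Assouad's method\<close>

lemma sum_Pow_split:
  fixes f :: "'a set \<Rightarrow> 'b::comm_monoid_add"
  assumes "finite J" "j \<in> J"
  shows "(\<Sum>\<theta>\<in>Pow J. f \<theta>) = (\<Sum>\<theta>\<in>Pow (J - {j}). f \<theta> + f (insert j \<theta>))"
proof -
  let ?K = "Pow (J - {j})"
  have "Pow J = Pow (insert j (J - {j}))" using assms(2) by (simp add: insert_absorb)
  also have "\<dots> = ?K \<union> insert j ` ?K" by (rule Pow_insert)
  finally have "(\<Sum>\<theta>\<in>Pow J. f \<theta>) = (\<Sum>\<theta>\<in>?K. f \<theta>) + (\<Sum>\<theta>\<in>insert j ` ?K. f \<theta>)"
    using assms(1) by (simp only:) (rule sum.union_disjoint, auto)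
  also have "(\<Sum>\<theta>\<in>insert j ` ?K. f \<theta>) = (\<Sum>\<theta>\<in>?K. f (insert j \<theta>))"
    by (subst sum.reindex) (auto simp: inj_on_def)
  finally show ?thesis by (simp add: sum.distrib)
qed

lemma borel_measurable_loss:
  assumes T: "T \<in> estimators n p" and S: "S \<in> carrier_mat p p"
  shows "(\<lambda>x. op_norm (T x - S)) \<in> borel_measurable (Pi\<^sub>M {..<n} (\<lambda>_. borel_pow p))"
proof (rule borel_measurable_op_norm)
  fix i j assume ij: "i < p" "j < p"
  have "(T x - S) $$ (i, j) = T x $$ (i, j) - S $$ (i, j)" for x
    using ij S by auto
  moreover have "(\<lambda>x. T x $$ (i, j)) \<in> borel_measurable (Pi\<^sub>M {..<n} (\<lambda>_. borel_pow p))"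
    using T ij unfolding estimators_def by blast
  ultimately show "(\<lambda>x. (T x - S) $$ (i, j)) \<in> borel_measurable (Pi\<^sub>M {..<n} (\<lambda>_. borel_pow p))"
    by (simp only:) (rule borel_measurable_diff, assumption, rule borel_measurable_const)
qed (rule minus_carrier_mat[OF S])

text \<open>
  The estimator induces a guess of every bit of \<open>\<theta>\<close>, by comparing the entry \<open>(0, j)\<close> with the midpoint
  \<open>u j\<close>. Averaged over all \<open>\<theta>\<close>, each bit is wrong with probability at least \<open>\<alpha> / 2\<close>, because flipping it
  gives a pair of hypotheses that no event separates well. So for some \<open>\<theta>\<close> the expected number of wrong bits
  is at least \<open>\<alpha> |J| / 2\<close>; as that number never exceeds \<open>|J|\<close>, it is at least \<open>\<alpha> |J| / 4\<close> with
  probability at least \<open>\<alpha> / 4\<close>. Every wrong bit costs at least \<open>h\<^sup>2\<close> in the squared norm of the first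
  row.
\<close>
lemma assouad:
  fixes L :: "nat set \<Rightarrow> (nat \<Rightarrow> nat \<Rightarrow> real) measure"
  assumes J: "J \<subseteq> {..<p}" "J \<noteq> {}" and h: "0 \<le> h" and \<alpha>: "0 \<le> \<alpha>"
    and prob: "\<And>\<theta>. \<theta> \<subseteq> J \<Longrightarrow> prob_space (L \<theta>)"
    and sets: "\<And>\<theta>. \<theta> \<subseteq> J \<Longrightarrow> sets (L \<theta>) = sets (Pi\<^sub>M {..<n} (\<lambda>_. borel_pow p))"
    and S: "\<And>\<theta>. \<theta> \<subseteq> J \<Longrightarrow> S \<theta> \<in> carrier_mat p p"
    and entry: "\<And>\<theta> j. \<theta> \<subseteq> J \<Longrightarrow> j \<in> J \<Longrightarrow> S \<theta> $$ (0, j) = u j + (if j \<in> \<theta> then h else - h)"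
    and test: "\<And>\<theta> j E. \<theta> \<subseteq> J \<Longrightarrow> j \<in> J \<Longrightarrow> j \<notin> \<theta> \<Longrightarrow> E \<in> sets (Pi\<^sub>M {..<n} (\<lambda>_. borel_pow p)) \<Longrightarrow>
      \<alpha> \<le> measure (L \<theta>) E + measure (L (insert j \<theta>)) (space (Pi\<^sub>M {..<n} (\<lambda>_. borel_pow p)) - E)"
    and T: "T \<in> estimators n p"
  obtains \<theta> where "\<theta> \<subseteq> J"
    "\<alpha> / 4 \<le> measure (L \<theta>) {x \<in> space (L \<theta>). h\<^sup>2 * \<alpha> * card J / 4 \<le> (op_norm (T x - S \<theta>))\<^sup>2}"
proof -
  let ?X = "Pi\<^sub>M {..<n} (\<lambda>_. borel_pow p)"
  have finJ: "finite J" using J finite_subset by blast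
  have p0: "0 < p" using J by (cases p) auto
  have cJ: "0 < card J" using finJ J by (simp add: card_gt_0_iff)
  have Tc: "T x \<in> carrier_mat p p" if "x \<in> space ?X" for x using T that by (simp add: estimators_def)
  have Tm: "(\<lambda>x. T x $$ (i, j)) \<in> borel_measurable ?X" if "i < p" "j < p" for i j
    using T that by (simp add: estimators_def)
  define E where "E j = {x \<in> space ?X. u j \<le> T x $$ (0, j)}" for j
  have E: "E j \<in> sets ?X" if "j \<in> J" for j
    unfolding E_def using Tm[OF p0, of j] J that by (auto simp: borel_measurable_iff_ge)
  define wrong where "wrong \<theta> j = (if j \<in> \<theta> then space ?X - E j else E j)" for \<theta> j
  have wrong: "wrong \<theta> j \<in> sets ?X" if "j \<in> J" for \<theta> j
    unfolding wrong_def using E[OF that] by auto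
  let ?m = "\<lambda>\<theta> j. measure (L \<theta>) (wrong \<theta> j)"
  have "real (card J) * \<alpha> / 2 * 2 ^ card J \<le> (\<Sum>j\<in>J. \<Sum>\<theta>\<in>Pow J. ?m \<theta> j)"
  proof -
    have "2 ^ (card J - 1) * \<alpha> \<le> (\<Sum>\<theta>\<in>Pow J. ?m \<theta> j)" if j: "j \<in> J" for j
    proof -
      have "real (card (Pow (J - {j}))) * \<alpha> \<le> (\<Sum>\<theta>\<in>Pow (J - {j}). ?m \<theta> j + ?m (insert j \<theta>) j)"
      proof (rule sum_bounded_below)
        fix \<theta> assume "\<theta> \<in> Pow (J - {j})"
        then have "\<theta> \<subseteq> J" "j \<notin> \<theta>" by auto
        then show "\<alpha> \<le> ?m \<theta> j + ?m (insert j \<theta>) j"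
          using test[OF _ j _ E[OF j], of \<theta>] by (simp add: wrong_def)
      qed
      then show ?thesis
        using finJ j unfolding sum_Pow_split[OF finJ j] by (simp add: card_Pow)
    qed
    then have "(\<Sum>j\<in>J. 2 ^ (card J - 1) * \<alpha>) \<le> (\<Sum>j\<in>J. \<Sum>\<theta>\<in>Pow J. ?m \<theta> j)"
      by (intro sum_mono)
    moreover have "(2::real) ^ card J = 2 * 2 ^ (card J - 1)"
      using cJ by (simp add: power_eq_if)
    ultimately show ?thesis by (simp add: mult_ac)
  qed
  also have "\<dots> = (\<Sum>\<theta>\<in>Pow J. \<Sum>j\<in>J. ?m \<theta> j)" by (rule sum.swap)
  finally have total: "real (card J) * \<alpha> / 2 * 2 ^ card J \<le> (\<Sum>\<theta>\<in>Pow J. \<Sum>j\<in>J. ?m \<theta> j)" .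
  have "\<exists>\<theta>\<in>Pow J. real (card J) * \<alpha> / 2 \<le> (\<Sum>j\<in>J. ?m \<theta> j)"
  proof (rule ccontr)
    assume "\<not> ?thesis"
    then have "(\<Sum>\<theta>\<in>Pow J. \<Sum>j\<in>J. ?m \<theta> j) < (\<Sum>\<theta>\<in>Pow J. real (card J) * \<alpha> / 2)"
      using finJ by (intro sum_strict_mono) (auto simp: not_le)
    then show False using total finJ by (simp add: card_Pow mult_ac)
  qed
  then obtain \<theta> where \<theta>: "\<theta> \<subseteq> J" and err: "real (card J) * \<alpha> / 2 \<le> (\<Sum>j\<in>J. ?m \<theta> j)" by auto
  interpret L: prob_space "L \<theta>" using prob[OF \<theta>] .
  note sL = sets[OF \<theta>]
  have spL: "space (L \<theta>) = space ?X" using sL by (rule sets_eq_imp_space_eq)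
  define N where "N x = (\<Sum>j\<in>J. indicator (wrong \<theta> j) x :: real)" for x
  define G where "G = {x \<in> space (L \<theta>). real (card J) * \<alpha> / 4 \<le> N x}"
  have [measurable]: "wrong \<theta> j \<in> sets (L \<theta>)" if "j \<in> J" for j using wrong[OF that] sL by simp
  have mN: "N \<in> borel_measurable (L \<theta>)"
    unfolding N_def by (intro borel_measurable_sum borel_measurable_indicator) simp
  then have G: "G \<in> sets (L \<theta>)" unfolding G_def borel_measurable_iff_ge by blast
  have N_le: "N x \<le> card J" for x
    unfolding N_def using sum_bounded_above[of J "\<lambda>j. indicator (wrong \<theta> j) x" "1::real"] by (simp add: indicator_def)
  have intN: "integrable (L \<theta>) N"
    unfolding N_def by (intro Bochner_Integration.integrable_sum) (simp add: L.emeasure_eq_measure)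
  have intG: "integrable (L \<theta>) (\<lambda>x. real (card J) * indicator G x + real (card J) * \<alpha> / 4)"
    using G by (intro Bochner_Integration.integrable_add) (auto simp: L.emeasure_eq_measure)
  have "(\<Sum>j\<in>J. ?m \<theta> j) = (\<integral>x. N x \<partial>L \<theta>)"
    unfolding N_def by (subst Bochner_Integration.integral_sum) (auto simp: L.emeasure_eq_measure intro!: sum.cong arg_cong[where f="measure _"]
        dest!: wrong sets.sets_into_space simp: spL)
  also have "\<dots> \<le> (\<integral>x. real (card J) * indicator G x + real (card J) * \<alpha> / 4 \<partial>L \<theta>)"
  proof (rule integral_mono[OF intN intG])
    fix x assume "x \<in> space (L \<theta>)"
    then show "N x \<le> real (card J) * indicator G x + real (card J) * \<alpha> / 4"
      using N_le[of x] \<alpha> by (cases "x \<in> G") (auto simp: G_def intro: add_increasing2)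
  qed
  also have "\<dots> = real (card J) * measure (L \<theta>) G + real (card J) * \<alpha> / 4"
    using G sets.sets_into_space[OF G]
    by (subst Bochner_Integration.integral_add) (auto simp: L.emeasure_eq_measure L.prob_space Int_absorb2)
  finally have "real (card J) * \<alpha> / 2 \<le> real (card J) * measure (L \<theta>) G + real (card J) * \<alpha> / 4"
    using err by linarith
  then have "real (card J) * (\<alpha> / 4) \<le> real (card J) * measure (L \<theta>) G" by (simp add: field_simps)
  then have PG: "\<alpha> / 4 \<le> measure (L \<theta>) G" using cJ by (simp only: mult_le_cancel_left_pos of_nat_0_less_iff)
  let ?D = "{x \<in> space (L \<theta>). h\<^sup>2 * \<alpha> * card J / 4 \<le> (op_norm (T x - S \<theta>))\<^sup>2}"
  have "G \<subseteq> ?D"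
  proof
    fix x assume x: "x \<in> G"
    then have xs: "x \<in> space ?X" by (simp add: G_def spL)
    have diff: "(T x - S \<theta>) $$ (0, j) = T x $$ (0, j) - S \<theta> $$ (0, j)" if "j \<in> J" for j
      using S[OF \<theta>] p0 that J by auto
    have "h\<^sup>2 * \<alpha> * card J / 4 = h\<^sup>2 * (card J * \<alpha> / 4)" by simp
    also have "\<dots> \<le> h\<^sup>2 * N x" using x by (intro mult_left_mono) (auto simp: G_def)
    also have "\<dots> \<le> (\<Sum>j\<in>J. ((T x - S \<theta>) $$ (0, j))\<^sup>2)"
      unfolding N_def sum_distrib_left
    proof (rule sum_mono)
      fix j assume j: "j \<in> J"
      show "h\<^sup>2 * indicator (wrong \<theta> j) x \<le> ((T x - S \<theta>) $$ (0, j))\<^sup>2"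
      proof (cases "x \<in> wrong \<theta> j")
        case True
        then have "\<bar>h\<bar> \<le> \<bar>(T x - S \<theta>) $$ (0, j)\<bar>"
          unfolding diff[OF j] entry[OF \<theta> j] using h xs by (auto simp: wrong_def E_def split: if_splits)
        then show ?thesis using True by (simp add: abs_le_square_iff)
      qed simp
    qed
    also have "\<dots> \<le> (op_norm (T x - S \<theta>))\<^sup>2"
      using Tc[OF xs] S[OF \<theta>] p0 J by (intro row_norm_le_op_norm) auto
    finally show "x \<in> ?D" using xs by (simp add: spL)
  qed
  moreover have "?D \<in> sets (L \<theta>)"
  proof -
    have "(\<lambda>x. op_norm (T x - S \<theta>)) \<in> borel_measurable ?X"
      by (rule borel_measurable_loss[OF T S[OF \<theta>]])
    then have "(\<lambda>x. (op_norm (T x - S \<theta>))\<^sup>2) \<in> borel_measurable (L \<theta>)"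
      unfolding measurable_cong_sets[OF sL refl] by (rule borel_measurable_power)
    then show ?thesis unfolding borel_measurable_iff_ge by blast
  qed
  ultimately have "\<alpha> / 4 \<le> measure (L \<theta>) ?D"
    by (intro order_trans[OF PG] L.finite_measure_mono)
  then show ?thesis using that \<theta> by blast
qed

text \<open>
  The common frame of all three lower bounds. A single bit, \<open>|J| = 1\<close>, is Le Cam's two-point method.
\<close>
lemma minimax_lower_bound_by_testing:
  assumes J: "J \<subseteq> {..<p}" "J \<noteq> {}" and h: "0 \<le> h" and \<alpha>: "0 \<le> \<alpha>" and \<epsilon>: "\<epsilon> \<in> {0..1}"
    and S: "\<And>\<theta>. \<theta> \<subseteq> J \<Longrightarrow> S \<theta> \<in> cov_class p M"
    and Q: "\<And>\<theta>. \<theta> \<subseteq> J \<Longrightarrow> Q \<theta> \<in> distributions p"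
    and entry: "\<And>\<theta> j. \<theta> \<subseteq> J \<Longrightarrow> j \<in> J \<Longrightarrow> S \<theta> $$ (0, j) = u j + (if j \<in> \<theta> then h else - h)"
    and test: "\<And>\<theta> j E. \<theta> \<subseteq> J \<Longrightarrow> j \<in> J \<Longrightarrow> j \<notin> \<theta> \<Longrightarrow> E \<in> sets (Pi\<^sub>M {..<n} (\<lambda>_. borel_pow p)) \<Longrightarrow>
      \<alpha> \<le> measure (sample_law n p \<epsilon> (S \<theta>) (Q \<theta>)) E
        + measure (sample_law n p \<epsilon> (S (insert j \<theta>)) (Q (insert j \<theta>))) (space (Pi\<^sub>M {..<n} (\<lambda>_. borel_pow p)) - E)"
    and r: "r \<le> h\<^sup>2 * \<alpha> * card J / 4"
  shows "ennreal (\<alpha> / 4) \<le> (INF \<Sigma>' \<in> estimators n p. SUP \<Sigma> \<in> cov_class p M. SUP Q \<in> distributions p.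
    emeasure (sample_law n p \<epsilon> \<Sigma> Q)
      {x \<in> space (sample_law n p \<epsilon> \<Sigma> Q). (op_norm (\<Sigma>' x - \<Sigma>))\<^sup>2 \<ge> r})"
proof (rule INF_greatest)
  fix T assume T: "T \<in> estimators n p"
  let ?L = "\<lambda>\<theta>. sample_law n p \<epsilon> (S \<theta>) (Q \<theta>)"
  have prob: "prob_space (?L \<theta>)" if "\<theta> \<subseteq> J" for \<theta>
    unfolding sample_law_def using Q[OF that] \<epsilon> by (intro prob_space_PiM prob_space_contaminated)
  have sets: "sets (?L \<theta>) = sets (Pi\<^sub>M {..<n} (\<lambda>_. borel_pow p))" for \<theta>
    unfolding sample_law_def by (intro sets_PiM_cong refl sets_contaminated)
  have Sc: "S \<theta> \<in> carrier_mat p p" if "\<theta> \<subseteq> J" for \<theta>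
    using S[OF that] by (simp add: cov_class_def)
  obtain \<theta> where \<theta>: "\<theta> \<subseteq> J"
    "\<alpha> / 4 \<le> measure (?L \<theta>) {x \<in> space (?L \<theta>). h\<^sup>2 * \<alpha> * card J / 4 \<le> (op_norm (T x - S \<theta>))\<^sup>2}"
    using assouad[where L = ?L, OF J h \<alpha> prob sets Sc entry test T] by blast
  interpret prob_space "?L \<theta>" by (rule prob[OF \<theta>(1)])
  have m: "(\<lambda>x. op_norm (T x - S \<theta>)) \<in> borel_measurable (?L \<theta>)"
    unfolding measurable_cong_sets[OF sets refl] by (rule borel_measurable_loss[OF T Sc[OF \<theta>(1)]])
  have "{x \<in> space (?L \<theta>). r \<le> (op_norm (T x - S \<theta>))\<^sup>2} \<in> sets (?L \<theta>)"
    using borel_measurable_power[OF m, of 2] unfolding borel_measurable_iff_ge by blast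
  then have "\<alpha> / 4 \<le> measure (?L \<theta>) {x \<in> space (?L \<theta>). r \<le> (op_norm (T x - S \<theta>))\<^sup>2}"
    using r by (intro order_trans[OF \<theta>(2)] finite_measure_mono) auto
  then have "ennreal (\<alpha> / 4) \<le> emeasure (?L \<theta>) {x \<in> space (?L \<theta>). r \<le> (op_norm (T x - S \<theta>))\<^sup>2}"
    by (simp add: emeasure_eq_measure)
  also have "\<dots> \<le> (SUP Q \<in> distributions p. emeasure (sample_law n p \<epsilon> (S \<theta>) Q)
      {x \<in> space (sample_law n p \<epsilon> (S \<theta>) Q). r \<le> (op_norm (T x - S \<theta>))\<^sup>2})"
    by (rule SUP_upper[OF Q[OF \<theta>(1)]])
  also have "\<dots> \<le> (SUP \<Sigma> \<in> cov_class p M. SUP Q \<in> distributions p. emeasure (sample_law n p \<epsilon> \<Sigma> Q)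
      {x \<in> space (sample_law n p \<epsilon> \<Sigma> Q). r \<le> (op_norm (T x - \<Sigma>))\<^sup>2})"
    by (rule SUP_upper[OF S[OF \<theta>(1)]])
  finally show "ennreal (\<alpha> / 4) \<le> \<dots>" .
qed

section \<open>Testing product measures\<close>

lemma PiM_density:
  fixes f :: "'i \<Rightarrow> 'a \<Rightarrow> ennreal"
  assumes I: "finite I" and sf: "\<And>i. sigma_finite_measure (M i)" "\<And>i. sigma_finite_measure (density (M i) (f i))"
    and f: "\<And>i. f i \<in> borel_measurable (M i)"
  shows "Pi\<^sub>M I (\<lambda>i. density (M i) (f i)) = density (Pi\<^sub>M I M) (\<lambda>x. \<Prod>i\<in>I. f i (x i))"
proof -
  interpret M: product_sigma_finite M using sf(1) by (simp only: product_sigma_finite_def simp_thms)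
  interpret D: product_sigma_finite "\<lambda>i. density (M i) (f i)" using sf(2) by (simp only: product_sigma_finite_def simp_thms)
  have sets: "sets (density (Pi\<^sub>M I M) (\<lambda>x. \<Prod>i\<in>I. f i (x i))) = sets (Pi\<^sub>M I (\<lambda>i. density (M i) (f i)))"
    unfolding sets_density by (rule sets_PiM_cong) (simp_all only: sets_density)
  have "density (Pi\<^sub>M I M) (\<lambda>x. \<Prod>i\<in>I. f i (x i)) = Pi\<^sub>M I (\<lambda>i. density (M i) (f i))"
  proof (rule D.PiM_eqI[OF I sets])
    fix A assume A: "\<And>i. i \<in> I \<Longrightarrow> A i \<in> sets (density (M i) (f i))"
    then have AM: "A i \<in> sets (M i)" if "i \<in> I" for i using that by simp
    have box: "Pi\<^sub>E I A \<in> sets (Pi\<^sub>M I M)" using I AM by (intro sets_PiM_I_finite)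
    have meas: "(\<lambda>x. \<Prod>i\<in>I. f i (x i)) \<in> borel_measurable (Pi\<^sub>M I M)"
      using f by (intro borel_measurable_prod_ennreal measurable_compose[OF measurable_component_singleton])
    have "emeasure (density (Pi\<^sub>M I M) (\<lambda>x. \<Prod>i\<in>I. f i (x i))) (Pi\<^sub>E I A)
      = (\<integral>\<^sup>+x. (\<Prod>i\<in>I. f i (x i)) * indicator (Pi\<^sub>E I A) x \<partial>Pi\<^sub>M I M)"
      by (rule emeasure_density[OF meas box])
    also have "\<dots> = (\<integral>\<^sup>+x. (\<Prod>i\<in>I. f i (x i) * indicator (A i) (x i)) \<partial>Pi\<^sub>M I M)"
    proof (rule nn_integral_cong)
      fix x assume "x \<in> space (Pi\<^sub>M I M)"
      then have "x \<in> extensional I" by (simp add: space_PiM PiE_def)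
      then have "indicator (Pi\<^sub>E I A) x = (\<Prod>i\<in>I. indicator (A i) (x i) :: ennreal)"
        using I by (auto simp: indicator_def PiE_iff)
      then show "(\<Prod>i\<in>I. f i (x i)) * indicator (Pi\<^sub>E I A) x = (\<Prod>i\<in>I. f i (x i) * indicator (A i) (x i))"
        by (simp only: prod.distrib)
    qed
    also have "\<dots> = (\<Prod>i\<in>I. \<integral>\<^sup>+y. f i y * indicator (A i) y \<partial>M i)"
      using I f AM by (intro M.product_nn_integral_prod) auto
    also have "\<dots> = (\<Prod>i\<in>I. emeasure (density (M i) (f i)) (A i))"
      using f AM by (intro prod.cong) (auto simp: emeasure_density)
    finally show "emeasure (density (Pi\<^sub>M I M) (\<lambda>x. \<Prod>i\<in>I. f i (x i))) (Pi\<^sub>E I A)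
      = (\<Prod>i\<in>I. emeasure (density (M i) (f i)) (A i))" .
  qed
  then show ?thesis by (rule sym)
qed

text \<open>
  With \<open>F\<close> and \<open>G\<close> the product densities, the two error probabilities add up to at least
  \<open>\<integral> min F G\<close>, and the affinity \<open>\<integral> \<surd>(F G) = \<integral> \<surd>(min F G) \<surd>(max F G)\<close> bounds the latter from below, as
  \<open>\<integral> max F G \<le> 2\<close>. The affinity is used because it is multiplicative over independent samples, so
  that parameters at distance of order \<open>1 / \<surd>n\<close> stay indistinguishable; total variation would only
  allow \<open>1 / n\<close>.
\<close>
lemma hellinger_testing_bound:
  fixes f g :: "'a \<Rightarrow> real" and I :: "'i set"
  assumes I: "finite I" and M: "sigma_finite_measure M"
    and f: "integrable M f" "\<And>x. 0 \<le> f x" "(\<integral>x. f x \<partial>M) = 1"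
    and g: "integrable M g" "\<And>x. 0 \<le> g x" "(\<integral>x. g x \<partial>M) = 1"
    and \<rho>: "0 < \<rho>" "\<rho> \<le> (\<integral>x. sqrt (f x * g x) \<partial>M)"
    and E: "E \<in> sets (Pi\<^sub>M I (\<lambda>_. M))"
  shows "\<rho> ^ (2 * card I) / 2 \<le> measure (Pi\<^sub>M I (\<lambda>_. density M f)) E
    + measure (Pi\<^sub>M I (\<lambda>_. density M g)) (space (Pi\<^sub>M I (\<lambda>_. M)) - E)"
proof -
  interpret sigma_finite_measure M by (rule M)
  interpret P: product_sigma_finite "\<lambda>_::'i. M" using M by (simp add: product_sigma_finite_def)
  let ?X = "Pi\<^sub>M I (\<lambda>_. M)"
  define F where "F x = (\<Prod>i\<in>I. f (x i))" for x :: "'i \<Rightarrow> 'a"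
  define G where "G x = (\<Prod>i\<in>I. g (x i))" for x :: "'i \<Rightarrow> 'a"
  define H where "H x = sqrt (F x * G x)" for x
  have F0: "0 \<le> F x" and G0: "0 \<le> G x" for x
    unfolding F_def G_def using f g by (auto intro: prod_nonneg)
  have intF: "integrable ?X F" and intG: "integrable ?X G"
    unfolding F_def[abs_def] G_def[abs_def] using I f(1) g(1) by (auto intro: P.product_integrable_prod)
  have integral_power: "(\<integral>x. (\<Prod>i\<in>I. k (x i)) \<partial>?X) = (\<integral>x. k x \<partial>M) ^ card I"
    if "integrable M k" for k :: "'a \<Rightarrow> real"
    using P.product_integral_prod[OF I, of "\<lambda>_. k"] that by (simp only: prod_constant)
  have F1: "(\<integral>x. F x \<partial>?X) = 1" and G1: "(\<integral>x. G x \<partial>?X) = 1"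
    unfolding F_def G_def integral_power[OF f(1)] integral_power[OF g(1)] f(3) g(3) by simp_all
  have inth: "integrable M (\<lambda>x. sqrt (f x * g x))"
  proof (rule Bochner_Integration.integrable_bound)
    show "integrable M (\<lambda>x. f x + g x)" using f g by simp
    show "(\<lambda>x. sqrt (f x * g x)) \<in> borel_measurable M" using f(1) g(1) by measurable
    have "sqrt (f x * g x) \<le> f x + g x" for x
      by (rule order_trans[OF arith_geo_mean_sqrt[OF f(2) g(2)]]) (use f(2)[of x] g(2)[of x] in simp)
    then show "AE x in M. norm (sqrt (f x * g x)) \<le> norm (f x + g x)" using f(2) g(2) by simp
  qed
  have Hprod: "H x = (\<Prod>i\<in>I. sqrt (f (x i) * g (x i)))" for x
    unfolding H_def F_def G_def prod.distrib[symmetric] by (induction I rule: infinite_finite_induct) (simp_all add: real_sqrt_mult)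
  have intH: "integrable ?X H"
    unfolding Hprod[abs_def] using I inth by (rule P.product_integrable_prod)
  have "\<rho> ^ card I \<le> (\<integral>x. sqrt (f x * g x) \<partial>M) ^ card I" using \<rho> by (intro power_mono) auto
  also have "\<dots> = (\<integral>x. H x \<partial>?X)"
    unfolding Hprod integral_power[OF inth] ..
  finally have \<rho>H: "\<rho> ^ card I \<le> (\<integral>x. H x \<partial>?X)" .
  define r where "r = \<rho> ^ card I"
  have r: "r > 0" unfolding r_def using \<rho> by simp
  have intmin: "integrable ?X (\<lambda>x. min (F x) (G x))" using intF intG by simp
  (* The arithmetic-geometric mean inequality, with the weight for which the smaller density gets
     the factor 1 / r and the larger one, of total mass at most 2, uses up only r / 2. *)
  have amgm: "H x \<le> min (F x) (G x) / r + r / 4 * (F x + G x)" for x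
  proof -
    define a b where "a = min (F x) (G x)" and "b = max (F x) (G x)"
    have ab: "0 \<le> a" "0 \<le> b" "F x * G x = a * b" "F x + G x = a + b"
      using F0[of x] G0[of x] by (auto simp: a_def b_def min_def max_def)
    have "sqrt (a * b) = sqrt ((2 * a / r) * (r / 2 * b))" using r by simp
    also have "\<dots> \<le> (2 * a / r + r / 2 * b) / 2"
      using ab r by (intro arith_geo_mean_sqrt) auto
    also have "\<dots> \<le> a / r + r / 4 * (a + b)" using ab r by (simp add: field_simps)
    finally show ?thesis unfolding H_def ab(3,4) a_def[symmetric] .
  qed
  have "r \<le> (\<integral>x. H x \<partial>?X)" using \<rho>H by (simp add: r_def)
  also have "\<dots> \<le> (\<integral>x. min (F x) (G x) / r + r / 4 * (F x + G x) \<partial>?X)"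
    using intF intG intmin by (intro integral_mono intH amgm) auto
  also have "\<dots> = (\<integral>x. min (F x) (G x) \<partial>?X) / r + r / 2"
    using intF intG intmin F1 G1 by simp
  finally have "r * r / 2 \<le> (\<integral>x. min (F x) (G x) \<partial>?X)"
    using r by (simp add: field_simps)
  also have "\<dots> \<le> (\<integral>x. F x * indicator E x + G x * indicator (space ?X - E) x \<partial>?X)"
  proof (rule integral_mono[OF intmin])
    show "integrable ?X (\<lambda>x. F x * indicator E x + G x * indicator (space ?X - E) x)"
      using intF intG E by (intro Bochner_Integration.integrable_add integrable_real_mult_indicator) auto
    fix x assume "x \<in> space ?X"
    then show "min (F x) (G x) \<le> F x * indicator E x + G x * indicator (space ?X - E) x"
      by (cases "x \<in> E") auto
  qed
  also have "\<dots> = (\<integral>x. F x * indicator E x \<partial>?X) + (\<integral>x. G x * indicator (space ?X - E) x \<partial>?X)"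
    using intF intG E by (intro Bochner_Integration.integral_add integrable_real_mult_indicator) auto
  finally have main: "r * r / 2 \<le> (\<integral>x. F x * indicator E x \<partial>?X) + (\<integral>x. G x * indicator (space ?X - E) x \<partial>?X)" .
  have dens: "measure (Pi\<^sub>M I (\<lambda>_. density M k)) A = (\<integral>x. (\<Prod>i\<in>I. k (x i)) * indicator A x \<partial>?X)"
    if k: "integrable M k" "\<And>x. 0 \<le> k x" "(\<integral>x. k x \<partial>M) = 1" and A: "A \<in> sets ?X" for k :: "'a \<Rightarrow> real" and A
  proof -
    have "prob_space (density M k)"
      using k by (intro prob_spaceI) (simp add: emeasure_density nn_integral_eq_integral cong: nn_integral_cong)
    then interpret K: prob_space "density M k" .
    have intk: "integrable ?X (\<lambda>x. \<Prod>i\<in>I. k (x i))" using I k(1) by (rule P.product_integrable_prod)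
    have "Pi\<^sub>M I (\<lambda>_. density M k) = density ?X (\<lambda>x. \<Prod>i\<in>I. ennreal (k (x i)))"
      using I k(1) M K.sigma_finite_measure_axioms by (intro PiM_density) auto
    also have "\<dots> = density ?X (\<lambda>x. ennreal (\<Prod>i\<in>I. k (x i)))"
      using k(2) by (simp add: prod_ennreal)
    finally have *: "Pi\<^sub>M I (\<lambda>_. density M k) = density ?X (\<lambda>x. ennreal (\<Prod>i\<in>I. k (x i)))" .
    have "emeasure (Pi\<^sub>M I (\<lambda>_. density M k)) A = (\<integral>\<^sup>+x. ennreal (\<Prod>i\<in>I. k (x i)) * indicator A x \<partial>?X)"
      unfolding * using A intk by (intro emeasure_density) auto
    also have "\<dots> = (\<integral>\<^sup>+x. ennreal ((\<Prod>i\<in>I. k (x i)) * indicator A x) \<partial>?X)"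
      by (intro nn_integral_cong) (auto simp: indicator_def)
    also have "\<dots> = ennreal (\<integral>x. (\<Prod>i\<in>I. k (x i)) * indicator A x \<partial>?X)"
      using A intk k(2)
      by (intro nn_integral_eq_integral integrable_real_mult_indicator AE_I2 mult_nonneg_nonneg prod_nonneg) auto
    finally show ?thesis
      using k(2) by (simp add: measure_def integral_nonneg prod_nonneg)
  qed
  have "r * r = \<rho> ^ (2 * card I)" unfolding r_def by (simp add: power_mult power2_eq_square power_mult_distrib power_even_eq)
  then show ?thesis
    using main dens[OF f E] dens[OF g sets.compl_sets[OF E]] by (simp add: F_def G_def)
qed

lemma PiM_distr_vimage:
  assumes I: "finite I" and N: "prob_space N" and G: "G \<in> measurable N K" and E: "E \<in> sets (Pi\<^sub>M I (\<lambda>_. K))"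
  shows "measure (Pi\<^sub>M I (\<lambda>_. distr N K G)) E
    = measure (Pi\<^sub>M I (\<lambda>_. N)) (compose I G -` E \<inter> space (Pi\<^sub>M I (\<lambda>_. N)))"
proof -
  let ?D = "distr N K G"
  have D: "prob_space ?D" using N G by (rule prob_space.prob_space_distr)
  have "distr N ?D G = distr N K G" by (rule distr_cong) auto
  then have "distr (Pi\<^sub>M I (\<lambda>_. N)) (Pi\<^sub>M I (\<lambda>_. ?D)) (compose I G) = Pi\<^sub>M I (\<lambda>_. ?D)"
    using distr_PiM_finite_prob_space'[OF I N D, of G] G by simp
  then have "measure (Pi\<^sub>M I (\<lambda>_. ?D)) E = measure (distr (Pi\<^sub>M I (\<lambda>_. N)) (Pi\<^sub>M I (\<lambda>_. ?D)) (compose I G)) E"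
    by (simp only:)
  also have "\<dots> = measure (Pi\<^sub>M I (\<lambda>_. N)) (compose I G -` E \<inter> space (Pi\<^sub>M I (\<lambda>_. N)))"
  proof (rule measure_distr)
    show "compose I G \<in> measurable (Pi\<^sub>M I (\<lambda>_. N)) (Pi\<^sub>M I (\<lambda>_. ?D))"
      unfolding compose_def
      by (intro measurable_restrict measurable_compose[OF measurable_component_singleton]) (simp_all add: G)
    show "E \<in> sets (Pi\<^sub>M I (\<lambda>_. ?D))" using E by (simp cong: sets_PiM_cong)
  qed
  finally show ?thesis .
qed

text \<open>
  Applying the same map to every observation cannot help a test. This keeps the density computations
  on a convenient reference space, even if the image laws are degenerate.
\<close>
lemma hellinger_testing_bound_image:
  fixes f g :: "'a \<Rightarrow> real" and I :: "'i set"
  assumes I: "finite I" and M: "sigma_finite_measure M"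
    and f: "integrable M f" "\<And>x. 0 \<le> f x" "(\<integral>x. f x \<partial>M) = 1"
    and g: "integrable M g" "\<And>x. 0 \<le> g x" "(\<integral>x. g x \<partial>M) = 1"
    and \<rho>: "0 < \<rho>" "\<rho> \<le> (\<integral>x. sqrt (f x * g x) \<partial>M)"
    and G: "G \<in> measurable M K" and E: "E \<in> sets (Pi\<^sub>M I (\<lambda>_. K))"
  shows "\<rho> ^ (2 * card I) / 2 \<le> measure (Pi\<^sub>M I (\<lambda>_. distr (density M f) K G)) E
    + measure (Pi\<^sub>M I (\<lambda>_. distr (density M g) K G)) (space (Pi\<^sub>M I (\<lambda>_. K)) - E)"
proof -
  let ?E' = "compose I G -` E \<inter> space (Pi\<^sub>M I (\<lambda>_. M))"
  have cG: "compose I G \<in> measurable (Pi\<^sub>M I (\<lambda>_. M)) (Pi\<^sub>M I (\<lambda>_. K))"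
    unfolding compose_def
    by (intro measurable_restrict measurable_compose[OF measurable_component_singleton]) (simp_all add: G)
  have E': "?E' \<in> sets (Pi\<^sub>M I (\<lambda>_. M))" using measurable_sets[OF cG E] .
  have prob: "prob_space (density M k)" if "integrable M k" "\<And>x. 0 \<le> k x" "(\<integral>x. k x \<partial>M) = 1" for k :: "'a \<Rightarrow> real"
    using that by (intro prob_spaceI) (simp add: emeasure_density nn_integral_eq_integral cong: nn_integral_cong)
  have Gd: "G \<in> measurable (density M k) K" for k using G by simp
  have sp: "space (Pi\<^sub>M I (\<lambda>_. density M k)) = space (Pi\<^sub>M I (\<lambda>_. M))" for k
    by (simp add: space_PiM)
  have compl: "compose I G -` (space (Pi\<^sub>M I (\<lambda>_. K)) - E) \<inter> space (Pi\<^sub>M I (\<lambda>_. M)) = space (Pi\<^sub>M I (\<lambda>_. M)) - ?E'"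
    using measurable_space[OF cG] by auto
  show ?thesis
    using hellinger_testing_bound[OF I M f g \<rho> E']
    unfolding PiM_distr_vimage[OF I prob[OF f] Gd E] PiM_distr_vimage[OF I prob[OF g] Gd sets.compl_sets[OF E]] sp compl .
qed

section \<open>Shears of the standard Gaussian\<close>

text \<open>
  A shear \<open>z\<^sub>0 \<mapsto> z\<^sub>0 + m(z)\<close>, with \<open>m\<close> a function of the other coordinates, acts as a translation in each
  fibre, so the density is the one-dimensional Gaussian shift density \<open>exp (m z\<^sub>0 - m\<^sup>2 / 2)\<close> in the fibre.
\<close>
lemma gauss_shear_density:
  fixes m :: "(nat \<Rightarrow> real) \<Rightarrow> real"
  assumes p: "0 < p" and m: "m \<in> borel_measurable (borel_pow p)"
    and indep: "\<And>z y. m (z(0 := y)) = m z"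
  shows "distr (std_gauss p) (borel_pow p) (\<lambda>z. z(0 := z 0 + m z))
    = density (std_gauss p) (\<lambda>z. ennreal (exp (m z * z 0 - (m z)\<^sup>2 / 2)))"
proof (rule measure_eqI)
  interpret N: prob_space "density lborel (\<lambda>x. ennreal (std_normal_density x))"
    by (rule prob_space_normal_density) auto
  interpret P: product_sigma_finite "\<lambda>_::nat. density lborel (\<lambda>x. ennreal (std_normal_density x))"
    by standard
  let ?S = "\<lambda>z::nat \<Rightarrow> real. z(0 := z 0 + m z)"
  let ?f = "\<lambda>z. ennreal (exp (m z * z 0 - (m z)\<^sup>2 / 2))"
  let ?R = "Pi\<^sub>M {1..<p} (\<lambda>_. density lborel (\<lambda>x. ennreal (std_normal_density x)))"
  have split: "{..<p} = insert 0 {1..<p}" using p by auto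
  have c0: "(\<lambda>z. z 0) \<in> borel_measurable (borel_pow p)"
    using p by (intro measurable_component_singleton) auto
  have S: "?S \<in> measurable (borel_pow p) (borel_pow p)"
    by (rule measurable_fun_upd[where J = "{..<p}"]) (use p c0 m in auto)
  have S': "?S \<in> measurable (std_gauss p) (borel_pow p)"
    using S unfolding measurable_cong_sets[OF sets_std_gauss refl] .
  have f: "?f \<in> borel_measurable (borel_pow p)"
    using m c0 by measurable
  show "sets (distr (std_gauss p) (borel_pow p) ?S) = sets (density (std_gauss p) ?f)"
    by (simp add: sets_std_gauss)
  fix A assume "A \<in> sets (distr (std_gauss p) (borel_pow p) ?S)"
  then have A: "A \<in> sets (borel_pow p)" by simp
  have upd: "(\<lambda>y. x(0 := y)) \<in> measurable borel (borel_pow p)" if "x \<in> space ?R" for x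
  proof -
    have "(\<lambda>y. x(0 := y)) \<in> measurable (density lborel (\<lambda>x. ennreal (std_normal_density x))) (std_gauss p)"
      using measurable_component_update[OF that, of 0] split by simp
    then show ?thesis
      using measurable_cong_sets[of "density lborel (\<lambda>x. ennreal (std_normal_density x))" borel, OF _ sets_std_gauss[of p]] by simp
  qed
  have fold: "(\<integral>\<^sup>+z. k z \<partial>std_gauss p) = (\<integral>\<^sup>+x. \<integral>\<^sup>+y. ennreal (std_normal_density y) * k (x(0 := y)) \<partial>lborel \<partial>?R)"
    if k: "k \<in> borel_measurable (borel_pow p)" for k :: "_ \<Rightarrow> ennreal"
  proof -
    have k': "k \<in> borel_measurable (Pi\<^sub>M (insert 0 {1..<p}) (\<lambda>_. density lborel (\<lambda>x. ennreal (std_normal_density x))))"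
      using k unfolding split[symmetric] measurable_cong_sets[OF sets_std_gauss refl] .
    have "(\<integral>\<^sup>+z. k z \<partial>std_gauss p) = (\<integral>\<^sup>+x. \<integral>\<^sup>+y. k (x(0 := y)) \<partial>density lborel (\<lambda>x. ennreal (std_normal_density x)) \<partial>?R)"
      unfolding split by (rule P.product_nn_integral_insert[OF _ _ k']) auto
    also have "\<dots> = (\<integral>\<^sup>+x. \<integral>\<^sup>+y. ennreal (std_normal_density y) * k (x(0 := y)) \<partial>lborel \<partial>?R)"
      by (intro nn_integral_cong nn_integral_density) (auto intro: measurable_compose[OF upd k])
    finally show ?thesis .
  qed
  have "emeasure (distr (std_gauss p) (borel_pow p) ?S) A
    = (\<integral>\<^sup>+z. indicator A z \<partial>distr (std_gauss p) (borel_pow p) ?S)"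
    using A by simp
  also have "\<dots> = (\<integral>\<^sup>+z. indicator A (?S z) \<partial>std_gauss p)"
    using A by (intro nn_integral_distr[OF S']) simp
  also have "\<dots> = (\<integral>\<^sup>+x. \<integral>\<^sup>+y. ennreal (std_normal_density y) * indicator A (x(0 := m x + 1 * y)) \<partial>lborel \<partial>?R)"
    using S A by (subst fold) (auto simp: indep add.commute intro: measurable_compose[OF S])
  also have "\<dots> = (\<integral>\<^sup>+x. \<integral>\<^sup>+y. ennreal (std_normal_density y) * (?f (x(0 := y)) * indicator A (x(0 := y))) \<partial>lborel \<partial>?R)"
  proof (rule nn_integral_cong)
    fix x assume x: "x \<in> space ?R"
    let ?g = "\<lambda>y. ennreal (std_normal_density (y - m x)) * indicator A (x(0 := y))"
    have "(\<lambda>y. indicator A (x(0 := y)) :: ennreal) \<in> borel_measurable borel"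
      using A by (intro measurable_compose[OF upd[OF x]]) auto
    then have g: "?g \<in> borel_measurable borel" by measurable
    have "(\<integral>\<^sup>+y. ennreal (std_normal_density y) * indicator A (x(0 := m x + 1 * y)) \<partial>lborel)
      = (\<integral>\<^sup>+y. ?g (m x + 1 * y) \<partial>lborel)" by simp
    also have "\<dots> = (\<integral>\<^sup>+y. ?g y \<partial>lborel)"
      using nn_integral_real_affine[OF g, of 1 "m x"] by simp
    also have "\<dots> = (\<integral>\<^sup>+y. ennreal (std_normal_density y) * (?f (x(0 := y)) * indicator A (x(0 := y))) \<partial>lborel)"
    proof (rule nn_integral_cong)
      fix y
      have "std_normal_density (y - m x) = std_normal_density y * exp (m x * y - (m x)\<^sup>2 / 2)"
        unfolding std_normal_density_def by (simp add: mult_exp_exp power2_eq_square field_simps)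
      then show "?g y = ennreal (std_normal_density y) * (?f (x(0 := y)) * indicator A (x(0 := y)))"
        by (simp add: indep ennreal_mult mult.assoc)
    qed
    finally show "(\<integral>\<^sup>+y. ennreal (std_normal_density y) * indicator A (x(0 := m x + 1 * y)) \<partial>lborel)
      = (\<integral>\<^sup>+y. ennreal (std_normal_density y) * (?f (x(0 := y)) * indicator A (x(0 := y))) \<partial>lborel)" .
  qed
  also have "\<dots> = (\<integral>\<^sup>+z. ?f z * indicator A z \<partial>std_gauss p)"
    using f A by (intro fold[symmetric] borel_measurable_times_ennreal borel_measurable_indicator)
  also have "\<dots> = emeasure (density (std_gauss p) ?f) A"
    using f A by (intro emeasure_density[symmetric]) (simp_all add: sets_std_gauss measurable_cong_sets[OF sets_std_gauss refl])
  finally show "emeasure (distr (std_gauss p) (borel_pow p) ?S) A = emeasure (density (std_gauss p) ?f) A" .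
qed

text \<open>
  The geometric mean of the shear densities of \<open>m\<close> and \<open>m'\<close> is the shear density of \<open>(m + m') / 2\<close>
  times \<open>exp (- (m - m')\<^sup>2 / 8)\<close>. The second factor does not involve the coordinate \<open>0\<close>, so the shear can
  be undone under the integral.
\<close>
lemma gauss_shear_affinity:
  fixes m m' :: "(nat \<Rightarrow> real) \<Rightarrow> real"
  assumes p: "0 < p"
    and m: "m \<in> borel_measurable (borel_pow p)" "\<And>z y. m (z(0 := y)) = m z"
    and m': "m' \<in> borel_measurable (borel_pow p)" "\<And>z y. m' (z(0 := y)) = m' z"
  shows "(\<integral>z. sqrt (exp (m z * z 0 - (m z)\<^sup>2 / 2) * exp (m' z * z 0 - (m' z)\<^sup>2 / 2)) \<partial>std_gauss p)
    = (\<integral>z. exp (- (m z - m' z)\<^sup>2 / 8) \<partial>std_gauss p)"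
proof -
  define c where "c z = (m z + m' z) / 2" for z
  let ?f = "\<lambda>z. exp (c z * z 0 - (c z)\<^sup>2 / 2)"
  let ?k = "\<lambda>z. exp (- (m z - m' z)\<^sup>2 / 8)"
  let ?S = "\<lambda>z::nat \<Rightarrow> real. z(0 := z 0 + c z)"
  have c: "c \<in> borel_measurable (borel_pow p)" "\<And>z y. c (z(0 := y)) = c z"
    unfolding c_def[abs_def] using m m' by auto
  have c0: "(\<lambda>z. z 0) \<in> borel_measurable (borel_pow p)"
    using p by (intro measurable_component_singleton) auto
  have k: "?k \<in> borel_measurable (borel_pow p)" using m(1) m'(1) by measurable
  have f: "?f \<in> borel_measurable (borel_pow p)" using c(1) c0 by measurable
  have S: "?S \<in> measurable (borel_pow p) (borel_pow p)"
    by (rule measurable_fun_upd[where J = "{..<p}"]) (use p c0 c in auto)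
  have "sqrt (exp (m z * z 0 - (m z)\<^sup>2 / 2) * exp (m' z * z 0 - (m' z)\<^sup>2 / 2)) = ?f z *\<^sub>R ?k z" for z
  proof -
    have "exp (m z * z 0 - (m z)\<^sup>2 / 2) * exp (m' z * z 0 - (m' z)\<^sup>2 / 2) = (?f z * ?k z)\<^sup>2"
      unfolding power2_eq_square mult_exp_exp c_def by (rule arg_cong[where f=exp]) (simp add: field_simps)
    then show ?thesis by (simp add: real_sqrt_unique)
  qed
  then have "(\<integral>z. sqrt (exp (m z * z 0 - (m z)\<^sup>2 / 2) * exp (m' z * z 0 - (m' z)\<^sup>2 / 2)) \<partial>std_gauss p)
    = (\<integral>z. ?f z *\<^sub>R ?k z \<partial>std_gauss p)" by (simp only:)
  also have "\<dots> = (\<integral>z. ?k z \<partial>density (std_gauss p) (\<lambda>z. ennreal (?f z)))"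
    using f k unfolding measurable_cong_sets[OF sets_std_gauss refl, symmetric]
    by (intro integral_density[symmetric]) auto
  also have "\<dots> = (\<integral>z. ?k z \<partial>distr (std_gauss p) (borel_pow p) ?S)"
    using gauss_shear_density[OF p c] by (simp only:)
  also have "\<dots> = (\<integral>z. ?k (?S z) \<partial>std_gauss p)"
    using S k unfolding measurable_cong_sets[OF sets_std_gauss refl, symmetric]
    by (intro integral_distr) (auto simp: measurable_cong_sets[OF sets_std_gauss refl])
  finally show ?thesis by (simp add: m(2) m'(2))
qed

lemma gauss_shear_integral:
  assumes p: "0 < p"
    and m: "m \<in> borel_measurable (borel_pow p)" "\<And>z y. m (z(0 := y)) = m z"
  shows "integrable (std_gauss p) (\<lambda>z. exp (m z * z 0 - (m z)\<^sup>2 / 2))"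
    and "(\<integral>z. exp (m z * z 0 - (m z)\<^sup>2 / 2) \<partial>std_gauss p) = 1"
proof -
  let ?f = "\<lambda>z. exp (m z * z 0 - (m z)\<^sup>2 / 2)"
  let ?S = "\<lambda>z::nat \<Rightarrow> real. z(0 := z 0 + m z)"
  have c0: "(\<lambda>z. z 0) \<in> borel_measurable (borel_pow p)"
    using p by (intro measurable_component_singleton) auto
  have S: "?S \<in> measurable (borel_pow p) (borel_pow p)"
    by (rule measurable_fun_upd[where J = "{..<p}"]) (use p c0 m in auto)
  have f: "?f \<in> borel_measurable (std_gauss p)"
    unfolding measurable_cong_sets[OF sets_std_gauss refl] using m(1) c0 by measurable
  have "prob_space (distr (std_gauss p) (borel_pow p) ?S)"
    using S by (intro prob_space.prob_space_distr prob_space_std_gauss) (simp add: measurable_cong_sets[OF sets_std_gauss refl])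
  then have "prob_space (density (std_gauss p) (\<lambda>z. ennreal (?f z)))"
    unfolding gauss_shear_density[OF p m] .
  then have "emeasure (density (std_gauss p) (\<lambda>z. ennreal (?f z))) (space (std_gauss p)) = 1"
    using prob_space.emeasure_space_1 by fastforce
  then have "(\<integral>\<^sup>+z. ennreal (?f z) \<partial>std_gauss p) = 1"
    using f by (simp add: emeasure_density cong: nn_integral_cong)
  then have "has_bochner_integral (std_gauss p) ?f 1"
    using f by (intro has_bochner_integral_nn_integral) auto
  then show "integrable (std_gauss p) ?f" "(\<integral>z. ?f z \<partial>std_gauss p) = 1"
    by (auto simp: has_bochner_integral_iff)
qed

lemma std_gauss_second_moment:
  assumes j: "j < p"
  shows "integrable (std_gauss p) (\<lambda>z. (z j)\<^sup>2)" and "(\<integral>z. (z j)\<^sup>2 \<partial>std_gauss p) = 1"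
proof -
  let ?N = "density lborel (\<lambda>x. ennreal (std_normal_density x))"
  have comp: "distr (std_gauss p) ?N (\<lambda>z. z j) = ?N"
    using j by (intro distr_PiM_component prob_space_normal_density) auto
  have proj: "(\<lambda>z. z j) \<in> measurable (std_gauss p) ?N"
    using j by (intro measurable_component_singleton) auto
  have "integrable lborel (\<lambda>x. std_normal_density x * x\<^sup>2)"
    by (rule integrable_std_normal_moment)
  then have "integrable ?N (\<lambda>x. x\<^sup>2)"
    by (subst integrable_density) auto
  then show "integrable (std_gauss p) (\<lambda>z. (z j)\<^sup>2)"
    using integrable_distr[OF proj, of "\<lambda>x. x\<^sup>2"] comp by simp
  have "(\<integral>z. (z j)\<^sup>2 \<partial>std_gauss p) = (\<integral>x. x\<^sup>2 \<partial>distr (std_gauss p) ?N (\<lambda>z. z j))"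
    by (rule integral_distr[symmetric, OF proj]) simp
  also have "\<dots> = (\<integral>x. std_normal_density x * x\<^sup>2 \<partial>lborel)"
    unfolding comp by (subst integral_density) auto
  also have "\<dots> = 1" using integral_std_normal_moment_even[of 1] by (simp add: fact_numeral)
  finally show "(\<integral>z. (z j)\<^sup>2 \<partial>std_gauss p) = 1" .
qed

text \<open>
  For mean functions that differ by \<open>2 \<eta> z\<^sub>j\<close> the affinity is \<open>E exp (- \<eta>\<^sup>2 z\<^sub>j\<^sup>2 / 2)\<close>, at least
  \<open>1 - \<eta>\<^sup>2 / 2\<close>, and its power \<open>2 n\<close> is at least \<open>1 - n \<eta>\<^sup>2\<close> by Bernoulli's inequality.
\<close>
lemma gauss_shear_testing:
  fixes m m' :: "(nat \<Rightarrow> real) \<Rightarrow> real"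
  assumes j: "j < p" and n: "0 < n" and \<eta>: "\<eta>\<^sup>2 * real n \<le> 1 / 2"
    and m: "m \<in> borel_measurable (borel_pow p)" "\<And>z y. m (z(0 := y)) = m z"
    and m': "m' \<in> borel_measurable (borel_pow p)" "\<And>z y. m' (z(0 := y)) = m' z"
    and diff: "\<And>z. \<bar>m z - m' z\<bar> = 2 * \<bar>\<eta> * z j\<bar>"
    and G: "G \<in> measurable (borel_pow p) (borel_pow p)"
    and E: "E \<in> sets (Pi\<^sub>M {..<n} (\<lambda>_. borel_pow p))"
  shows "1 / 4 \<le> measure (Pi\<^sub>M {..<n} (\<lambda>_. distr (std_gauss p) (borel_pow p) (\<lambda>z. G (z(0 := z 0 + m z))))) E
    + measure (Pi\<^sub>M {..<n} (\<lambda>_. distr (std_gauss p) (borel_pow p) (\<lambda>z. G (z(0 := z 0 + m' z)))))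
        (space (Pi\<^sub>M {..<n} (\<lambda>_. borel_pow p)) - E)"
proof -
  have p: "0 < p" using j by simp
  interpret \<gamma>: prob_space "std_gauss p" by (rule prob_space_std_gauss)
  have c0: "(\<lambda>z. z 0) \<in> borel_measurable (borel_pow p)"
    using p by (intro measurable_component_singleton) auto
  have cj: "(\<lambda>z. z j) \<in> borel_measurable (std_gauss p)"
    unfolding measurable_cong_sets[OF sets_std_gauss refl] using j by (intro measurable_component_singleton) auto
  have G': "G \<in> measurable (std_gauss p) (borel_pow p)"
    using G unfolding measurable_cong_sets[OF sets_std_gauss refl] .
  have push: "distr (std_gauss p) (borel_pow p) (\<lambda>z. G (z(0 := z 0 + k z)))
     = distr (density (std_gauss p) (\<lambda>z. ennreal (exp (k z * z 0 - (k z)\<^sup>2 / 2)))) (borel_pow p) G"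
    if k: "k \<in> borel_measurable (borel_pow p)" "\<And>z y. k (z(0 := y)) = k z" for k
  proof -
    have S: "(\<lambda>z. z(0 := z 0 + k z)) \<in> measurable (borel_pow p) (borel_pow p)"
      by (rule measurable_fun_upd[where J = "{..<p}"]) (use p c0 k in auto)
    have "distr (std_gauss p) (borel_pow p) (\<lambda>z. G (z(0 := z 0 + k z)))
      = distr (distr (std_gauss p) (borel_pow p) (\<lambda>z. z(0 := z 0 + k z))) (borel_pow p) G"
      using S by (subst distr_distr[OF G]) (simp_all add: measurable_cong_sets[OF sets_std_gauss refl] comp_def)
    then show ?thesis unfolding gauss_shear_density[OF p k] .
  qed
  have "\<eta>\<^sup>2 * 1 \<le> \<eta>\<^sup>2 * real n" using n by (intro mult_left_mono) auto
  then have \<eta>1: "\<eta>\<^sup>2 \<le> 1 / 2" using \<eta> by linarith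
  have \<rho>: "1 - \<eta>\<^sup>2 / 2 \<le> (\<integral>z. sqrt (exp (m z * z 0 - (m z)\<^sup>2 / 2) * exp (m' z * z 0 - (m' z)\<^sup>2 / 2)) \<partial>std_gauss p)"
  proof -
    have sq: "(m z - m' z)\<^sup>2 = 4 * \<eta>\<^sup>2 * (z j)\<^sup>2" for z
    proof -
      have "(m z - m' z)\<^sup>2 = \<bar>m z - m' z\<bar>\<^sup>2" by simp
      then show ?thesis unfolding diff by (simp add: power_mult_distrib)
    qed
    have "1 - \<eta>\<^sup>2 / 2 = (\<integral>z. 1 - \<eta>\<^sup>2 / 2 * (z j)\<^sup>2 \<partial>std_gauss p)"
      using std_gauss_second_moment[OF j] by (simp add: \<gamma>.prob_space)
    also have "\<dots> \<le> (\<integral>z. exp (- (\<eta>\<^sup>2 / 2 * (z j)\<^sup>2)) \<partial>std_gauss p)"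
    proof (rule integral_mono)
      show "integrable (std_gauss p) (\<lambda>z. 1 - \<eta>\<^sup>2 / 2 * (z j)\<^sup>2)"
        using std_gauss_second_moment[OF j] by simp
      show "integrable (std_gauss p) (\<lambda>z. exp (- (\<eta>\<^sup>2 / 2 * (z j)\<^sup>2)))"
        using cj by (intro \<gamma>.integrable_const_bound[of _ 1]) auto
      show "1 - \<eta>\<^sup>2 / 2 * (z j)\<^sup>2 \<le> exp (- (\<eta>\<^sup>2 / 2 * (z j)\<^sup>2))" for z
        using exp_ge_add_one_self[of "- (\<eta>\<^sup>2 / 2 * (z j)\<^sup>2)"] by simp
    qed
    also have "\<dots> = (\<integral>z. exp (- (m z - m' z)\<^sup>2 / 8) \<partial>std_gauss p)"
      by (simp add: sq)
    finally show ?thesis unfolding gauss_shear_affinity[OF p m m'] .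
  qed
  have "1 / 2 \<le> 1 + real (2 * n) * (- \<eta>\<^sup>2 / 2)" using \<eta> by (simp add: mult.commute)
  also have "\<dots> \<le> (1 + - \<eta>\<^sup>2 / 2) ^ (2 * n)" using \<eta>1 by (intro Bernoulli_inequality) simp
  finally have "1 / 4 \<le> (1 - \<eta>\<^sup>2 / 2) ^ (2 * card {..<n}) / 2" by simp
  also have "\<dots> \<le> measure (Pi\<^sub>M {..<n} (\<lambda>_. distr (std_gauss p) (borel_pow p) (\<lambda>z. G (z(0 := z 0 + m z))))) E
    + measure (Pi\<^sub>M {..<n} (\<lambda>_. distr (std_gauss p) (borel_pow p) (\<lambda>z. G (z(0 := z 0 + m' z)))))
        (space (Pi\<^sub>M {..<n} (\<lambda>_. borel_pow p)) - E)"
    unfolding push[OF m] push[OF m']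
    using \<eta>1 by (intro hellinger_testing_bound_image \<gamma>.sigma_finite_measure_axioms gauss_shear_integral[OF p m]
      gauss_shear_integral[OF p m'] \<rho> G' E) auto
  finally show ?thesis .
qed

section \<open>The dimension term: a regression with unknown signs\<close>

lemma mvn_in_distributions: "mvn p \<Sigma> \<in> distributions p"
  by (simp add: distributions_def prob_space_mvn sets_mvn)

text \<open>
  Contaminating a normal law by itself changes nothing, so the worst case over \<open>Q\<close> includes the
  uncontaminated problem.
\<close>
lemma self_contaminated:
  assumes \<epsilon>: "\<epsilon> \<in> {0..1}"
  shows "contaminated p \<epsilon> \<Sigma> (mvn p \<Sigma>) = mvn p \<Sigma>"
proof (rule measure_eqI)
  show "sets (contaminated p \<epsilon> \<Sigma> (mvn p \<Sigma>)) = sets (mvn p \<Sigma>)"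
    by (simp add: sets_contaminated sets_mvn)
  fix B assume "B \<in> sets (contaminated p \<epsilon> \<Sigma> (mvn p \<Sigma>))"
  then have B: "B \<in> sets (borel_pow p)" by (simp add: sets_contaminated)
  have "ennreal (1 - \<epsilon>) + ennreal \<epsilon> = 1" using \<epsilon> by (simp flip: ennreal_plus)
  then show "emeasure (contaminated p \<epsilon> \<Sigma> (mvn p \<Sigma>)) B = emeasure (mvn p \<Sigma>) B"
    unfolding emeasure_contaminated[OF mvn_in_distributions B] by (simp flip: distrib_right)
qed

lemma sample_law_self_contaminated:
  assumes "\<epsilon> \<in> {0..1}"
  shows "sample_law n p \<epsilon> \<Sigma> (mvn p \<Sigma>) = Pi\<^sub>M {..<n} (\<lambda>_. mvn p \<Sigma>)"
  unfolding sample_law_def self_contaminated[OF assms] ..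

text \<open>
  For standard normal \<open>Z\<close>, the vector \<open>X = regression_mat p a \<eta> \<theta> Z\<close> is a linear regression: the
  coordinates \<open>X\<^sub>1, \<dots>, X\<^sub>p\<^sub>-\<^sub>1\<close> are independent covariates and \<open>X\<^sub>0\<close> is a response with coefficients \<open>\<plusminus>\<eta>\<close>,
  the signs being given by \<open>\<theta>\<close>. Estimating the first row of the covariance amounts to recovering the
  signs.
\<close>
definition regression_mat :: "nat \<Rightarrow> real \<Rightarrow> real \<Rightarrow> nat set \<Rightarrow> real mat" where
  "regression_mat p a \<eta> \<theta> = mat p p (\<lambda>(i, j).
     if i = j then a else if i = 0 then (if j \<in> \<theta> then a * \<eta> else - (a * \<eta>)) else 0)"

definition regression_mean :: "nat \<Rightarrow> real \<Rightarrow> nat set \<Rightarrow> (nat \<Rightarrow> real) \<Rightarrow> real" where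
  "regression_mean p \<eta> \<theta> z = (\<Sum>j\<in>{1..<p}. (if j \<in> \<theta> then \<eta> else - \<eta>) * z j)"

lemma regression_mat_carrier: "regression_mat p a \<eta> \<theta> \<in> carrier_mat p p"
  by (simp add: regression_mat_def)

lemma regression_mat_apply:
  assumes "i < p"
  shows "(\<Sum>j<p. regression_mat p a \<eta> \<theta> $$ (i, j) * z j) = a * (z(0 := z 0 + regression_mean p \<eta> \<theta> z)) i"
proof (cases "i = 0")
  case True
  have "{..<p} = insert 0 {1..<p}" using assms by auto
  then have "(\<Sum>j<p. regression_mat p a \<eta> \<theta> $$ (i, j) * z j)
    = a * z 0 + (\<Sum>j\<in>{1..<p}. regression_mat p a \<eta> \<theta> $$ (i, j) * z j)"
    using True assms by (simp add: regression_mat_def)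
  also have "(\<Sum>j\<in>{1..<p}. regression_mat p a \<eta> \<theta> $$ (i, j) * z j) = a * regression_mean p \<eta> \<theta> z"
    unfolding regression_mean_def sum_distrib_left using True assms
    by (intro sum.cong) (auto simp: regression_mat_def)
  finally show ?thesis using True by (simp add: algebra_simps)
next
  case False
  have "(\<Sum>j<p. regression_mat p a \<eta> \<theta> $$ (i, j) * z j) = (\<Sum>j<p. if j = i then a * z j else 0)"
    using False assms by (intro sum.cong) (auto simp: regression_mat_def)
  then show ?thesis using False assms by simp
qed

lemma regression_gram_entry:
  assumes j: "j \<in> {1..<p}"
  shows "(regression_mat p a \<eta> \<theta> * transpose_mat (regression_mat p a \<eta> \<theta>)) $$ (0, j)
    = (if j \<in> \<theta> then a\<^sup>2 * \<eta> else - (a\<^sup>2 * \<eta>))"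
proof -
  let ?B = "regression_mat p a \<eta> \<theta>"
  have "(?B * transpose_mat ?B) $$ (0, j) = (\<Sum>k<p. ?B $$ (0, k) * ?B $$ (j, k))"
    using j by (intro gram_nth regression_mat_carrier) auto
  also have "\<dots> = (\<Sum>k<p. if k = j then (if j \<in> \<theta> then a * \<eta> else - (a * \<eta>)) * a else 0)"
    using j by (intro sum.cong) (auto simp: regression_mat_def)
  finally have "(?B * transpose_mat ?B) $$ (0, j)
    = (\<Sum>k<p. if k = j then (if j \<in> \<theta> then a * \<eta> else - (a * \<eta>)) * a else 0)" .
  then show ?thesis using j by (simp add: power2_eq_square)
qed

text \<open>
  The condition \<open>\<eta>\<^sup>2 p \<le> 1\<close> keeps the squared norm of the coefficient vector below \<open>1\<close>, so the response
  has bounded variance although it depends on all covariates. This is where a bound on \<open>p / n\<close> enters.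
\<close>
lemma regression_gram_cov_class:
  assumes p: "0 < p" and \<eta>: "\<eta>\<^sup>2 * real p \<le> 1" and M: "3 * a\<^sup>2 \<le> M"
  shows "regression_mat p a \<eta> \<theta> * transpose_mat (regression_mat p a \<eta> \<theta>) \<in> cov_class p M"
proof (rule gram_in_cov_class[OF regression_mat_carrier p])
  show "0 \<le> M" using M order_trans[of 0 "3 * a\<^sup>2" M] by simp
  fix v :: "real vec" assume v: "v \<in> carrier_vec p"
  let ?B = "regression_mat p a \<eta> \<theta>" and ?R = "\<Sum>j\<in>{1..<p}. (v $ j)\<^sup>2"
  define s where "s = regression_mean p \<eta> \<theta> (\<lambda>j. v $ j)"
  have split: "(\<Sum>i<p. f i) = f 0 + (\<Sum>i\<in>{1..<p}. f i)" for f :: "nat \<Rightarrow> real"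
    using p by (simp add: lessThan_atLeast0 sum.atLeast_Suc_lessThan)
  have R0: "0 \<le> ?R" by (intro sum_nonneg) simp
  have "s\<^sup>2 \<le> (\<Sum>j\<in>{1..<p}. (if j \<in> \<theta> then \<eta> else - \<eta>)\<^sup>2) * ?R"
    unfolding s_def regression_mean_def by (rule Cauchy_Schwarz_ineq_sum)
  also have "(\<Sum>j\<in>{1..<p}. (if j \<in> \<theta> then \<eta> else - \<eta>)\<^sup>2) = (\<Sum>j\<in>{1..<p}. \<eta>\<^sup>2)"
    by (intro sum.cong) auto
  also have "\<dots> * ?R \<le> (\<eta>\<^sup>2 * real p) * ?R"
    using R0 by (intro mult_right_mono) (auto simp: mult.commute intro: mult_right_mono)
  also have "\<dots> \<le> 1 * ?R" using \<eta> R0 by (intro mult_right_mono)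
  finally have s: "s\<^sup>2 \<le> ?R" by simp
  have Bv: "(?B *\<^sub>v v) $ i = a * ((\<lambda>j. v $ j)(0 := v $ 0 + s)) i" if "i < p" for i
    unfolding mult_mat_vec_nth[OF regression_mat_carrier v that] s_def by (rule regression_mat_apply[OF that])
  have "(vec_l2norm (?B *\<^sub>v v))\<^sup>2 = (\<Sum>i<p. (a * ((\<lambda>j. v $ j)(0 := v $ 0 + s)) i)\<^sup>2)"
    unfolding vec_l2norm_sq_eq_sum[OF mult_mat_vec_carrier[OF regression_mat_carrier v]]
    by (intro sum.cong refl) (simp only: Bv lessThan_iff)
  also have "\<dots> = a\<^sup>2 * ((v $ 0 + s)\<^sup>2 + ?R)"
    unfolding power_mult_distrib sum_distrib_left[symmetric] split by simp
  also have "\<dots> \<le> a\<^sup>2 * (3 * ((v $ 0)\<^sup>2 + ?R))"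
  proof (intro mult_left_mono)
    have "0 \<le> (v $ 0 - s)\<^sup>2" by simp
    then have "(v $ 0 + s)\<^sup>2 \<le> 2 * (v $ 0)\<^sup>2 + 2 * s\<^sup>2" by (simp add: power2_eq_square algebra_simps)
    moreover have "0 \<le> (v $ 0)\<^sup>2" by simp
    moreover have "x + w \<le> 3 * (y + w)" if "x \<le> 2 * y + 2 * z" "0 \<le> y" "z \<le> w" for x y z w :: real
      unfolding distrib_left using that by linarith
    ultimately show "(v $ 0 + s)\<^sup>2 + ?R \<le> 3 * ((v $ 0)\<^sup>2 + ?R)" using s by blast
  qed simp
  also have "\<dots> = 3 * a\<^sup>2 * (vec_l2norm v)\<^sup>2"
    unfolding vec_l2norm_sq_eq_sum[OF v] split by simp
  also have "\<dots> \<le> M * (vec_l2norm v)\<^sup>2" using M by (intro mult_right_mono) auto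
  finally show "(vec_l2norm (?B *\<^sub>v v))\<^sup>2 \<le> M * (vec_l2norm v)\<^sup>2" .
qed

lemma regression_mvn:
  assumes p: "0 < p"
  shows "mvn p (regression_mat p a \<eta> \<theta> * transpose_mat (regression_mat p a \<eta> \<theta>))
    = distr (std_gauss p) (borel_pow p) (\<lambda>z. (\<lambda>z. \<lambda>i\<in>{..<p}. a * z i) (z(0 := z 0 + regression_mean p \<eta> \<theta> z)))"
proof -
  have "linear_image p (regression_mat p a \<eta> \<theta>) z = (\<lambda>i\<in>{..<p}. a * (z(0 := z 0 + regression_mean p \<eta> \<theta> z)) i)" for z
    unfolding linear_image_def by (intro restrict_ext) (simp only: regression_mat_apply lessThan_iff)
  then have "linear_image p (regression_mat p a \<eta> \<theta>) = (\<lambda>z. \<lambda>i\<in>{..<p}. a * (z(0 := z 0 + regression_mean p \<eta> \<theta> z)) i)"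
    by (rule ext)
  then show ?thesis unfolding mvn_gram[OF regression_mat_carrier] by (simp only:)
qed

text \<open>
  Assouad's method over the signs of the regression. The entries \<open>\<plusminus>a\<^sup>2 \<eta>\<close> with \<open>\<eta>\<^sup>2\<close> of order \<open>1 / n\<close> add up, over
  \<open>p - 1\<close> coordinates, to a squared error of order \<open>p / n\<close>.
\<close>
lemma minimax_lower_bound_dimension:
  fixes M \<kappa> :: real
  assumes M: "0 < M" and p: "2 \<le> p" and n: "1 \<le> n" and \<epsilon>: "\<epsilon> \<in> {0..1}"
    and \<kappa>: "0 \<le> \<kappa>" "\<kappa> \<le> 1 / 2" "\<kappa> * (real p / real n) \<le> 1"
    and r: "r \<le> M\<^sup>2 * \<kappa> / 288 * (real p / real n)"
  shows "ennreal (1 / 16) \<le> (INF \<Sigma>' \<in> estimators n p. SUP \<Sigma> \<in> cov_class p M. SUP Q \<in> distributions p.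
    emeasure (sample_law n p \<epsilon> \<Sigma> Q)
      {x \<in> space (sample_law n p \<epsilon> \<Sigma> Q). (op_norm (\<Sigma>' x - \<Sigma>))\<^sup>2 \<ge> r})"
proof -
  (* a is the largest scale with 3 * a\<^sup>2 \<le> M, as membership in the class requires; with \<eta>\<^sup>2 = \<kappa> / n, flipping one
     sign is hard to detect from n observations and the coefficient vector has norm at most 1. *)
  define a where "a = sqrt (M / 3)"
  define \<eta> where "\<eta> = sqrt (\<kappa> / real n)"
  have a2: "a\<^sup>2 = M / 3" using M by (simp add: a_def)
  have \<eta>2: "\<eta>\<^sup>2 = \<kappa> / real n" using \<kappa> by (simp add: \<eta>_def)
  define J where "J = {1..<p}"
  let ?B = "\<lambda>\<theta>. regression_mat p a \<eta> \<theta>"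
  define S where "S \<theta> = ?B \<theta> * transpose_mat (?B \<theta>)" for \<theta>
  let ?G = "\<lambda>z::nat \<Rightarrow> real. \<lambda>i\<in>{..<p}. a * z i"
  have G: "?G \<in> measurable (borel_pow p) (borel_pow p)" by measurable
  have law: "sample_law n p \<epsilon> (S \<theta>) (mvn p (S \<theta>))
    = Pi\<^sub>M {..<n} (\<lambda>_. distr (std_gauss p) (borel_pow p) (\<lambda>z. ?G (z(0 := z 0 + regression_mean p \<eta> \<theta> z))))" for \<theta>
    unfolding sample_law_self_contaminated[OF \<epsilon>] unfolding S_def using p by (subst regression_mvn) auto
  have mean: "regression_mean p \<eta> \<theta> \<in> borel_measurable (borel_pow p)"
    "regression_mean p \<eta> \<theta> (z(0 := y)) = regression_mean p \<eta> \<theta> z" for \<theta> z y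
    unfolding regression_mean_def[abs_def]
    by (intro borel_measurable_sum borel_measurable_times borel_measurable_const measurable_component_singleton, simp)
       (intro sum.cong, auto)
  have "ennreal (1 / 4 / 4) \<le> (INF \<Sigma>' \<in> estimators n p. SUP \<Sigma> \<in> cov_class p M. SUP Q \<in> distributions p.
    emeasure (sample_law n p \<epsilon> \<Sigma> Q)
      {x \<in> space (sample_law n p \<epsilon> \<Sigma> Q). (op_norm (\<Sigma>' x - \<Sigma>))\<^sup>2 \<ge> r})"
  proof (rule minimax_lower_bound_by_testing[where J = J and S = S and Q = "\<lambda>\<theta>. mvn p (S \<theta>)" and u = "\<lambda>_. 0" and h = "a\<^sup>2 * \<eta>"])
    show "J \<subseteq> {..<p}" "J \<noteq> {}" using p by (auto simp: J_def)
    show "0 \<le> a\<^sup>2 * \<eta>" using \<kappa> by (simp add: \<eta>_def)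
    show "\<epsilon> \<in> {0..1}" by (rule \<epsilon>)
    show "mvn p (S \<theta>) \<in> distributions p" for \<theta> by (rule mvn_in_distributions)
    show "S \<theta> \<in> cov_class p M" for \<theta>
      unfolding S_def using p \<kappa> M by (intro regression_gram_cov_class) (auto simp: a2 \<eta>2)
    show "S \<theta> $$ (0, j) = 0 + (if j \<in> \<theta> then a\<^sup>2 * \<eta> else - (a\<^sup>2 * \<eta>))" if "j \<in> J" for \<theta> j
      using that unfolding S_def J_def by (simp add: regression_gram_entry del: index_mult_mat)
    show "r \<le> (a\<^sup>2 * \<eta>)\<^sup>2 * (1 / 4) * real (card J) / 4"
    proof -
      (* p - 1 \<ge> p / 2, and 288 = 2 * 16 * 9 with the 9 from a\<^sup>4 = M\<^sup>2 / 9. *)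
      have "M\<^sup>2 * \<kappa> / 288 * (real p / real n) = M\<^sup>2 * \<kappa> / (144 * real n) * (real p / 2)" by simp
      also have "\<dots> \<le> M\<^sup>2 * \<kappa> / (144 * real n) * real (p - 1)"
        using p \<kappa> by (intro mult_left_mono) auto
      also have "\<dots> = (a\<^sup>2 * \<eta>)\<^sup>2 * (1 / 4) * real (card J) / 4"
        unfolding power_mult_distrib \<eta>2 a2 by (simp add: J_def power2_eq_square)
      finally show ?thesis using r by linarith
    qed
    show "1 / 4 \<le> measure (sample_law n p \<epsilon> (S \<theta>) (mvn p (S \<theta>))) E
      + measure (sample_law n p \<epsilon> (S (insert j \<theta>)) (mvn p (S (insert j \<theta>)))) (space (Pi\<^sub>M {..<n} (\<lambda>_. borel_pow p)) - E)"
      if j: "j \<in> J" "j \<notin> \<theta>" and E: "E \<in> sets (Pi\<^sub>M {..<n} (\<lambda>_. borel_pow p))" for \<theta> j E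
      unfolding law
    proof (rule gauss_shear_testing[OF _ _ _ mean mean _ G E])
      show "j < p" "0 < n" using j n by (auto simp: J_def)
      show "\<eta>\<^sup>2 * real n \<le> 1 / 2" using \<kappa> n by (simp add: \<eta>2)
      fix z :: "nat \<Rightarrow> real"
      have "regression_mean p \<eta> \<theta> z - regression_mean p \<eta> (insert j \<theta>) z = (\<Sum>i\<in>{1..<p}. if i = j then - (2 * \<eta> * z i) else 0)"
        unfolding regression_mean_def sum_subtractf[symmetric] using j(2) by (intro sum.cong) auto
      also have "\<dots> = - (2 * \<eta> * z j)" using j by (simp add: J_def)
      finally show "\<bar>regression_mean p \<eta> \<theta> z - regression_mean p \<eta> (insert j \<theta>) z\<bar> = 2 * \<bar>\<eta> * z j\<bar>"
        by (simp add: abs_mult)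
    qed
  qed simp
  then show ?thesis by simp
qed

section \<open>One-dimensional scale families\<close>

text \<open>
  The remaining bounds only vary the variance along the first axis. All other coordinates are
  kept at \<open>0\<close>, so that the problem is one-dimensional in any ambient dimension.
\<close>
definition axis_embedding :: "nat \<Rightarrow> real \<Rightarrow> nat \<Rightarrow> real" where
  "axis_embedding p x = (\<lambda>i\<in>{..<p}. if i = 0 then x else 0)"

definition axis_mat :: "nat \<Rightarrow> real \<Rightarrow> real mat" where
  "axis_mat p \<sigma> = mat p p (\<lambda>(i, j). if i = 0 \<and> j = 0 then \<sigma> else 0)"

definition axis_cov :: "nat \<Rightarrow> real \<Rightarrow> real mat" where
  "axis_cov p \<sigma> = axis_mat p \<sigma> * transpose_mat (axis_mat p \<sigma>)"

lemma axis_mat_carrier: "axis_mat p \<sigma> \<in> carrier_mat p p"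
  by (simp add: axis_mat_def)

lemma axis_mat_apply:
  assumes "i < p"
  shows "(\<Sum>j<p. axis_mat p \<sigma> $$ (i, j) * z j) = (if i = 0 then \<sigma> * z 0 else 0)"
proof -
  have "(\<Sum>j<p. axis_mat p \<sigma> $$ (i, j) * z j) = (\<Sum>j<p. if j = 0 then (if i = 0 then \<sigma> * z 0 else 0) else 0)"
    using assms by (intro sum.cong) (auto simp: axis_mat_def)
  then show ?thesis using assms by auto
qed

lemma axis_cov_entry:
  assumes p: "0 < p"
  shows "axis_cov p \<sigma> $$ (0, 0) = \<sigma>\<^sup>2"
proof -
  have "axis_cov p \<sigma> $$ (0, 0) = (\<Sum>k<p. axis_mat p \<sigma> $$ (0, k) * axis_mat p \<sigma> $$ (0, k))"
    unfolding axis_cov_def by (rule gram_nth[OF axis_mat_carrier p p])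
  also have "\<dots> = \<sigma> * axis_mat p \<sigma> $$ (0, 0)"
    using axis_mat_apply[OF p, of \<sigma> "\<lambda>k. axis_mat p \<sigma> $$ (0, k)"] by simp
  finally show ?thesis using p by (simp add: axis_mat_def power2_eq_square)
qed

lemma axis_cov_class:
  assumes p: "0 < p" and M: "\<sigma>\<^sup>2 \<le> M"
  shows "axis_cov p \<sigma> \<in> cov_class p M"
  unfolding axis_cov_def
proof (rule gram_in_cov_class[OF axis_mat_carrier p])
  show "0 \<le> M" using M order_trans[of 0 "\<sigma>\<^sup>2" M] by simp
  fix v :: "real vec" assume v: "v \<in> carrier_vec p"
  have "(vec_l2norm (axis_mat p \<sigma> *\<^sub>v v))\<^sup>2 = (\<Sum>i<p. (if i = 0 then \<sigma> * v $ 0 else 0)\<^sup>2)"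
    unfolding vec_l2norm_sq_eq_sum[OF mult_mat_vec_carrier[OF axis_mat_carrier v]]
    by (intro sum.cong refl) (simp only: mult_mat_vec_nth[OF axis_mat_carrier v] axis_mat_apply lessThan_iff)
  also have "\<dots> = (\<Sum>i<p. if i = 0 then \<sigma>\<^sup>2 * (v $ 0)\<^sup>2 else 0)"
    by (intro sum.cong) (auto simp: power_mult_distrib)
  also have "\<dots> = \<sigma>\<^sup>2 * (v $ 0)\<^sup>2" using p by simp
  also have "\<dots> \<le> \<sigma>\<^sup>2 * (\<Sum>i<p. (v $ i)\<^sup>2)"
    using p by (intro mult_left_mono member_le_sum) auto
  also have "\<dots> \<le> M * (\<Sum>i<p. (v $ i)\<^sup>2)" using M by (intro mult_right_mono sum_nonneg) auto
  finally show "(vec_l2norm (axis_mat p \<sigma> *\<^sub>v v))\<^sup>2 \<le> M * (vec_l2norm v)\<^sup>2"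
    unfolding vec_l2norm_sq_eq_sum[OF v] .
qed

lemma measurable_axis_embedding: "axis_embedding p \<in> measurable borel (borel_pow p)"
  unfolding axis_embedding_def[abs_def] by measurable

lemma axis_mvn:
  assumes p: "0 < p" and \<sigma>: "0 < \<sigma>"
  shows "mvn p (axis_cov p \<sigma>) = distr (density lborel (normal_density 0 \<sigma>)) (borel_pow p) (axis_embedding p)"
proof -
  let ?N = "density lborel (\<lambda>x. ennreal (std_normal_density x))"
  interpret N: prob_space ?N by (rule prob_space_normal_density) simp
  have "distributed ?N lborel (\<lambda>x. x) std_normal_density"
    unfolding distributed_def by (simp add: distr_id2)
  then have "distributed ?N lborel (\<lambda>x. \<sigma> * x) (normal_density 0 \<sigma>)"
    using N.normal_density_affine[of "\<lambda>x. x" 0 1 \<sigma> 0] \<sigma> by simp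
  then have scaled: "distr ?N lborel (\<lambda>x. \<sigma> * x) = density lborel (normal_density 0 \<sigma>)"
    by (rule distributed_distr_eq_density)
  have proj: "(\<lambda>z. z 0) \<in> measurable (std_gauss p) ?N"
    using p by (intro measurable_component_singleton) auto
  have mult: "(\<lambda>x. \<sigma> * x) \<in> measurable ?N lborel" by simp
  have emb: "axis_embedding p \<in> measurable lborel (borel_pow p)" using measurable_axis_embedding by simp
  have "linear_image p (axis_mat p \<sigma>) z = axis_embedding p (\<sigma> * z 0)" for z
    unfolding linear_image_def axis_embedding_def by (intro restrict_ext) (simp only: axis_mat_apply lessThan_iff)
  then have "linear_image p (axis_mat p \<sigma>) = axis_embedding p \<circ> ((\<lambda>x. \<sigma> * x) \<circ> (\<lambda>z. z 0))" by auto
  then have "mvn p (axis_cov p \<sigma>) = distr (std_gauss p) (borel_pow p) (axis_embedding p \<circ> ((\<lambda>x. \<sigma> * x) \<circ> (\<lambda>z. z 0)))"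
    unfolding axis_cov_def mvn_gram[OF axis_mat_carrier] by (simp only:)
  also have "\<dots> = distr (distr (distr (std_gauss p) ?N (\<lambda>z. z 0)) lborel (\<lambda>x. \<sigma> * x)) (borel_pow p) (axis_embedding p)"
    using proj mult emb by (simp only: distr_distr measurable_comp)
  also have "distr (std_gauss p) ?N (\<lambda>z. z 0) = ?N"
    using p by (intro distr_PiM_component prob_space_normal_density) auto
  finally show ?thesis unfolding scaled .
qed

text \<open>
  The geometric mean of two centred normal densities is a multiple of the normal density whose
  precision is the mean of the two precisions.
\<close>
lemma normal_scale_affinity:
  assumes \<sigma>: "0 < \<sigma>" and \<tau>: "0 < \<tau>"
  shows "(\<integral>x. sqrt (normal_density 0 \<sigma> x * normal_density 0 \<tau> x) \<partial>lborel) = sqrt (2 * \<sigma> * \<tau> / (\<sigma>\<^sup>2 + \<tau>\<^sup>2))"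
proof -
  define v where "v = 2 * \<sigma>\<^sup>2 * \<tau>\<^sup>2 / (\<sigma>\<^sup>2 + \<tau>\<^sup>2)"
  have s: "\<sigma>\<^sup>2 + \<tau>\<^sup>2 > 0" using \<sigma> by (intro add_pos_nonneg) auto
  have v: "v > 0" unfolding v_def using \<sigma> \<tau> s by simp
  have c: "2 * \<sigma> * \<tau> / (\<sigma>\<^sup>2 + \<tau>\<^sup>2) = v / (\<sigma> * \<tau>)"
    unfolding v_def using \<sigma> \<tau> by (simp add: power2_eq_square)
  have "sqrt (normal_density 0 \<sigma> x * normal_density 0 \<tau> x) = sqrt (v / (\<sigma> * \<tau>)) * normal_density 0 (sqrt v) x" for x
  proof (rule real_sqrt_unique)
    have e: "- (x\<^sup>2 / (2 * v)) + - (x\<^sup>2 / (2 * v)) = - (x\<^sup>2 / (2 * \<sigma>\<^sup>2)) + - (x\<^sup>2 / (2 * \<tau>\<^sup>2))"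
      unfolding v_def using \<sigma> \<tau> s by (simp add: field_simps)
    have "(sqrt (v / (\<sigma> * \<tau>)) * normal_density 0 (sqrt v) x)\<^sup>2
      = v / (\<sigma> * \<tau>) * (1 / (2 * pi * v) * (exp (- (x\<^sup>2 / (2 * v))) * exp (- (x\<^sup>2 / (2 * v)))))"
      unfolding normal_density_def using v \<sigma> \<tau> by (simp add: power_mult_distrib power_divide power2_eq_square[of "exp _"])
    also have "\<dots> = 1 / (2 * pi * (\<sigma> * \<tau>)) * (exp (- (x\<^sup>2 / (2 * \<sigma>\<^sup>2))) * exp (- (x\<^sup>2 / (2 * \<tau>\<^sup>2))))"
      unfolding mult_exp_exp e using v \<sigma> \<tau> by simp
    also have "\<dots> = normal_density 0 \<sigma> x * normal_density 0 \<tau> x"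
    proof -
      have "sqrt (2 * pi * \<sigma>\<^sup>2) * sqrt (2 * pi * \<tau>\<^sup>2) = 2 * pi * (\<sigma> * \<tau>)"
      proof -
        have "2 * pi * \<sigma>\<^sup>2 * (2 * pi * \<tau>\<^sup>2) = (2 * pi * (\<sigma> * \<tau>))\<^sup>2"
          by (simp add: power2_eq_square)
        then show ?thesis using \<sigma> \<tau> by (simp only: real_sqrt_mult[symmetric]) simp
      qed
      then show ?thesis unfolding normal_density_def by simp
    qed
    finally show "(sqrt (v / (\<sigma> * \<tau>)) * normal_density 0 (sqrt v) x)\<^sup>2 = normal_density 0 \<sigma> x * normal_density 0 \<tau> x" .
    show "0 \<le> sqrt (v / (\<sigma> * \<tau>)) * normal_density 0 (sqrt v) x" using v \<sigma> \<tau> by simp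
  qed
  then show ?thesis using v by (simp add: c)
qed

text \<open>
  The wider density has the flatter exponential, so only the normalising constants matter.
\<close>
lemma normal_scale_dominated:
  assumes \<sigma>: "0 < \<sigma>" and \<tau>: "\<sigma> \<le> \<tau>"
  shows "\<sigma> / \<tau> * normal_density 0 \<sigma> x \<le> normal_density 0 \<tau> x"
proof -
  have sq: "\<sigma>\<^sup>2 \<le> \<tau>\<^sup>2" using assms by (intro power_mono) auto
  have "x\<^sup>2 / (2 * \<tau>\<^sup>2) \<le> x\<^sup>2 / (2 * \<sigma>\<^sup>2)" using sq assms by (intro divide_left_mono mult_pos_pos zero_less_power) auto
  then have "exp (- (x\<^sup>2 / (2 * \<sigma>\<^sup>2))) \<le> exp (- (x\<^sup>2 / (2 * \<tau>\<^sup>2)))" by simp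
  then have "1 / (sqrt (2 * pi) * \<tau>) * exp (- (x\<^sup>2 / (2 * \<sigma>\<^sup>2))) \<le> 1 / (sqrt (2 * pi) * \<tau>) * exp (- (x\<^sup>2 / (2 * \<tau>\<^sup>2)))"
    using assms by (intro mult_left_mono) auto
  then show ?thesis using assms by (simp add: normal_density_def real_sqrt_mult mult_ac)
qed

lemma minimax_lower_bound_by_variance:
  assumes p: "0 < p" and \<epsilon>: "\<epsilon> \<in> {0..1}" and \<alpha>: "0 \<le> \<alpha>"
    and \<sigma>: "0 < \<sigma>" "\<sigma> \<le> \<tau>" "\<tau>\<^sup>2 \<le> M"
    and Q: "Q0 \<in> distributions p" "Q1 \<in> distributions p"
    and test: "\<And>E. E \<in> sets (Pi\<^sub>M {..<n} (\<lambda>_. borel_pow p)) \<Longrightarrow>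
      \<alpha> \<le> measure (sample_law n p \<epsilon> (axis_cov p \<sigma>) Q0) E
        + measure (sample_law n p \<epsilon> (axis_cov p \<tau>) Q1) (space (Pi\<^sub>M {..<n} (\<lambda>_. borel_pow p)) - E)"
    and r: "r \<le> ((\<tau>\<^sup>2 - \<sigma>\<^sup>2) / 2)\<^sup>2 * \<alpha> / 4"
  shows "ennreal (\<alpha> / 4) \<le> (INF \<Sigma>' \<in> estimators n p. SUP \<Sigma> \<in> cov_class p M. SUP Q \<in> distributions p.
    emeasure (sample_law n p \<epsilon> \<Sigma> Q)
      {x \<in> space (sample_law n p \<epsilon> \<Sigma> Q). (op_norm (\<Sigma>' x - \<Sigma>))\<^sup>2 \<ge> r})"
proof (rule minimax_lower_bound_by_testing[where J = "{0}" and S = "\<lambda>\<theta>. axis_cov p (if 0 \<in> \<theta> then \<tau> else \<sigma>)"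
      and Q = "\<lambda>\<theta>. if 0 \<in> \<theta> then Q1 else Q0" and u = "\<lambda>_. (\<sigma>\<^sup>2 + \<tau>\<^sup>2) / 2" and h = "(\<tau>\<^sup>2 - \<sigma>\<^sup>2) / 2"])
  have le: "\<sigma>\<^sup>2 \<le> \<tau>\<^sup>2" using \<sigma> by (intro power_mono) auto
  show "{0} \<subseteq> {..<p}" using p by simp
  show "0 \<le> (\<tau>\<^sup>2 - \<sigma>\<^sup>2) / 2" using le by simp
  show "axis_cov p (if 0 \<in> \<theta> then \<tau> else \<sigma>) \<in> cov_class p M" for \<theta> :: "nat set"
    using le \<sigma>(3) p by (intro axis_cov_class) auto
  show "axis_cov p (if 0 \<in> \<theta> then \<tau> else \<sigma>) $$ (0, j)
      = (\<sigma>\<^sup>2 + \<tau>\<^sup>2) / 2 + (if j \<in> \<theta> then (\<tau>\<^sup>2 - \<sigma>\<^sup>2) / 2 else - ((\<tau>\<^sup>2 - \<sigma>\<^sup>2) / 2))"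
    if "j \<in> {0}" for \<theta> :: "nat set" and j
    using that p by (simp add: axis_cov_entry field_simps)
  show "r \<le> ((\<tau>\<^sup>2 - \<sigma>\<^sup>2) / 2)\<^sup>2 * \<alpha> * real (card {0::nat}) / 4" using r by simp
qed (use \<alpha> \<epsilon> Q test in auto)

text \<open>
  The rate \<open>1 / n\<close> in fixed dimension, from estimating a single variance. The regression family says
  nothing for \<open>p = 1\<close>, where it has no covariate.
\<close>
lemma minimax_lower_bound_sampling:
  assumes M: "0 < M" and p: "0 < p" and n: "1 \<le> n" and \<epsilon>: "\<epsilon> \<in> {0..1}" and r: "r \<le> M\<^sup>2 / (128 * real n)"
  shows "ennreal (1 / 16) \<le> (INF \<Sigma>' \<in> estimators n p. SUP \<Sigma> \<in> cov_class p M. SUP Q \<in> distributions p.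
    emeasure (sample_law n p \<epsilon> \<Sigma> Q)
      {x \<in> space (sample_law n p \<epsilon> \<Sigma> Q). (op_norm (\<Sigma>' x - \<Sigma>))\<^sup>2 \<ge> r})"
proof -
  (* The squared affinity of the two normal laws is at least 1 - \<delta>\<^sup>2, and
     (1 - \<delta>\<^sup>2) ^ n \<ge> 1 - n \<delta>\<^sup>2 = 1 / 2. *)
  define \<delta> where "\<delta> = sqrt (1 / (2 * real n))"
  define \<tau> where "\<tau> = sqrt M"
  define \<sigma> where "\<sigma> = (1 - \<delta>) * \<tau>"
  have \<delta>2: "\<delta>\<^sup>2 = 1 / (2 * real n)" by (simp add: \<delta>_def)
  have \<delta>0: "0 < \<delta>" using n by (simp add: \<delta>_def)
  have "\<delta>\<^sup>2 < 1\<^sup>2" using n by (simp add: \<delta>2)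
  then have \<delta>1: "\<delta> < 1" by (rule power_less_imp_less_base) simp
  have \<tau>: "0 < \<tau>" "\<tau>\<^sup>2 = M" using M by (auto simp: \<tau>_def)
  have \<sigma>: "0 < \<sigma>" "\<sigma> \<le> \<tau>" using \<delta>0 \<delta>1 \<tau> by (auto simp: \<sigma>_def mult_le_cancel_right1)
  define \<rho> where "\<rho> = 2 * \<sigma> * \<tau> / (\<sigma>\<^sup>2 + \<tau>\<^sup>2)"
  have "1 - \<delta>\<^sup>2 \<le> \<rho>"
  proof -
    have s: "0 < (1 - \<delta>)\<^sup>2 + 1" by (intro add_nonneg_pos) auto
    have "\<rho> = (2 * (1 - \<delta>)) * M / (((1 - \<delta>)\<^sup>2 + 1) * M)"
    proof -
      have "2 * \<sigma> * \<tau> = (2 * (1 - \<delta>)) * M"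
        unfolding \<sigma>_def \<tau>(2)[symmetric] by (simp add: power2_eq_square)
      moreover have "\<sigma>\<^sup>2 + \<tau>\<^sup>2 = ((1 - \<delta>)\<^sup>2 + 1) * M"
        unfolding \<sigma>_def power_mult_distrib \<tau>(2) by (simp add: distrib_right)
      ultimately show ?thesis unfolding \<rho>_def by (simp only:)
    qed
    also have "\<dots> = (2 * (1 - \<delta>)) / ((1 - \<delta>)\<^sup>2 + 1)" using M by simp
    also have "\<dots> = 1 - \<delta>\<^sup>2 / ((1 - \<delta>)\<^sup>2 + 1)" using s by (simp add: field_simps power2_eq_square)
    also have "\<dots> \<ge> 1 - \<delta>\<^sup>2 / 1"
      using s by (intro diff_left_mono divide_left_mono) auto
    finally show ?thesis by simp
  qed
  moreover have "1 / 2 \<le> (1 + - \<delta>\<^sup>2) ^ n"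
  proof -
    have "1 / 2 = 1 + real n * (- \<delta>\<^sup>2)" using n by (simp add: \<delta>2)
    also have "\<dots> \<le> (1 + - \<delta>\<^sup>2) ^ n"
      using \<open>\<delta>\<^sup>2 < 1\<^sup>2\<close> by (intro Bernoulli_inequality) simp
    finally show ?thesis .
  qed
  moreover have "0 < \<rho>" unfolding \<rho>_def using \<sigma> \<tau> by (intro divide_pos_pos add_pos_pos) auto
  ultimately have \<rho>: "0 < sqrt \<rho>" "1 / 2 \<le> \<rho> ^ n"
    using \<open>\<delta>\<^sup>2 < 1\<^sup>2\<close> power_mono[of "1 - \<delta>\<^sup>2" \<rho> n] by auto
  have "sqrt \<rho> ^ (2 * n) = \<rho> ^ n" using \<open>0 < \<rho>\<close> by (simp add: power_mult)
  let ?L = "\<lambda>\<sigma>. sample_law n p \<epsilon> (axis_cov p \<sigma>) (mvn p (axis_cov p \<sigma>))"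
  have law: "?L s = Pi\<^sub>M {..<n} (\<lambda>_. distr (density lborel (normal_density 0 s)) (borel_pow p) (axis_embedding p))"
    if "0 < s" for s
    using sample_law_self_contaminated[OF \<epsilon>, of n p "axis_cov p s"] unfolding axis_mvn[OF p that] .
  have "ennreal (1 / 4 / 4) \<le> (INF \<Sigma>' \<in> estimators n p. SUP \<Sigma> \<in> cov_class p M. SUP Q \<in> distributions p.
    emeasure (sample_law n p \<epsilon> \<Sigma> Q)
      {x \<in> space (sample_law n p \<epsilon> \<Sigma> Q). (op_norm (\<Sigma>' x - \<Sigma>))\<^sup>2 \<ge> r})"
  proof (rule minimax_lower_bound_by_variance[OF p \<epsilon> _ \<sigma> _ mvn_in_distributions mvn_in_distributions])
    fix E assume E: "E \<in> sets (Pi\<^sub>M {..<n} (\<lambda>_. borel_pow p))"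
    have "sqrt \<rho> ^ (2 * card {..<n}) / 2 \<le> measure (?L \<sigma>) E + measure (?L \<tau>) (space (Pi\<^sub>M {..<n} (\<lambda>_. borel_pow p)) - E)"
      unfolding law[OF \<sigma>(1)] law[OF \<tau>(1)]
      using \<sigma>(1) \<tau>(1) \<rho>(1) E measurable_axis_embedding
      by (intro hellinger_testing_bound_image lborel.sigma_finite_measure_axioms)
         (auto simp: normal_scale_affinity \<rho>_def)
    then show "1 / 4 \<le> measure (?L \<sigma>) E + measure (?L \<tau>) (space (Pi\<^sub>M {..<n} (\<lambda>_. borel_pow p)) - E)"
      using \<rho>(2) \<open>sqrt \<rho> ^ (2 * n) = \<rho> ^ n\<close> by simp
  next
    show "\<tau>\<^sup>2 \<le> M" using \<tau> by simp
    have "\<delta> * M / 2 \<le> (\<tau>\<^sup>2 - \<sigma>\<^sup>2) / 2"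
    proof -
      have "\<tau>\<^sup>2 - \<sigma>\<^sup>2 = M * (\<delta> + \<delta> * (1 - \<delta>))"
        unfolding \<sigma>_def power_mult_distrib \<tau>(2) by (simp add: power2_eq_square algebra_simps)
      also have "\<dots> \<ge> M * \<delta>" using M \<delta>0 \<delta>1 by (intro mult_left_mono) auto
      finally show ?thesis by (simp add: mult.commute)
    qed
    then have "(\<delta> * M / 2)\<^sup>2 \<le> ((\<tau>\<^sup>2 - \<sigma>\<^sup>2) / 2)\<^sup>2"
      using \<delta>0 M by (intro power_mono) auto
    moreover have "(\<delta> * M / 2)\<^sup>2 = M\<^sup>2 / (8 * real n)"
      unfolding power_divide power_mult_distrib \<delta>2 by simp
    moreover have "M\<^sup>2 / (8 * real n) / 16 = M\<^sup>2 / (128 * real n)" by simp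
    ultimately show "r \<le> ((\<tau>\<^sup>2 - \<sigma>\<^sup>2) / 2)\<^sup>2 * (1 / 4) / 4"
      using r by simp
  qed simp
  then show ?thesis by simp
qed

section \<open>The contamination term\<close>

text \<open>
  If \<open>N(0, \<Sigma>')\<close> dominates the clean part \<open>(1 - \<epsilon>) N(0, \<Sigma>)\<close>, then the contamination can be chosen as the
  normalised remainder, and the data carry no trace of \<open>\<Sigma>\<close>.
\<close>
lemma contaminated_eq_of_dominated:
  assumes \<epsilon>: "0 < \<epsilon>" "\<epsilon> \<le> 1"
    and dom: "\<And>B. B \<in> sets (borel_pow p) \<Longrightarrow> ennreal (1 - \<epsilon>) * emeasure (mvn p \<Sigma>) B \<le> emeasure (mvn p \<Sigma>') B"
  obtains Q where "Q \<in> distributions p" "contaminated p \<epsilon> \<Sigma> Q = mvn p \<Sigma>'"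
proof -
  interpret P0: prob_space "mvn p \<Sigma>" by (rule prob_space_mvn)
  interpret P1: prob_space "mvn p \<Sigma>'" by (rule prob_space_mvn)
  define N where "N = scale_measure (ennreal (1 - \<epsilon>)) (mvn p \<Sigma>)"
  have setsN: "sets N = sets (borel_pow p)" by (simp add: N_def sets_mvn)
  have eN: "emeasure N B = ennreal (1 - \<epsilon>) * emeasure (mvn p \<Sigma>) B" for B
    by (simp add: N_def)
  have finN: "finite_measure N"
    by (rule finite_measureI) (simp add: eN N_def space_scale_measure P0.emeasure_space_1)
  define D where "D = diff_measure (mvn p \<Sigma>') N"
  have D: "emeasure D B = emeasure (mvn p \<Sigma>') B - emeasure N B" if "B \<in> sets (borel_pow p)" for B
    unfolding D_def
    by (rule emeasure_diff_measure) (use that dom in \<open>auto simp: sets_mvn setsN eN finN intro: P1.finite_measure_axioms\<close>)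
  define Q where "Q = scale_measure (ennreal (1 / \<epsilon>)) D"
  have setsQ: "sets Q = sets (borel_pow p)" by (simp add: Q_def D_def sets_mvn)
  have sp: "space (mvn p \<Sigma>) = space (borel_pow p)" "space (mvn p \<Sigma>') = space (borel_pow p)" for \<Sigma> \<Sigma>'
    by (rule sets_eq_imp_space_eq[OF sets_mvn])+
  have eQ: "ennreal \<epsilon> * emeasure Q B = emeasure (mvn p \<Sigma>') B - ennreal (1 - \<epsilon>) * emeasure (mvn p \<Sigma>) B"
    if "B \<in> sets (borel_pow p)" for B
  proof -
    have "ennreal \<epsilon> * emeasure Q B = (ennreal \<epsilon> * ennreal (1 / \<epsilon>)) * emeasure D B"
      by (simp add: Q_def mult.assoc)
    also have "ennreal \<epsilon> * ennreal (1 / \<epsilon>) = 1" using \<epsilon> by (simp flip: ennreal_mult')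
    finally show ?thesis using D[OF that] by (simp add: eN)
  qed
  have "ennreal \<epsilon> * emeasure Q (space (borel_pow p)) = ennreal \<epsilon>"
    using eQ[of "space (borel_pow p)"] P0.emeasure_space_1 P1.emeasure_space_1 \<epsilon>
    by (simp add: sp) (simp add: ennreal_minus flip: ennreal_1)
  then have "emeasure Q (space (borel_pow p)) = 1"
    using \<epsilon> by (metis ennreal_mult_cancel_left ennreal_eq_0_iff ennreal_neq_top mult.right_neutral not_le)
  then have "prob_space Q"
    using sets_eq_imp_space_eq[OF setsQ] by (intro prob_spaceI) simp
  then have Q: "Q \<in> distributions p" using setsQ by (simp add: distributions_def)
  have "contaminated p \<epsilon> \<Sigma> Q = mvn p \<Sigma>'"
  proof (rule measure_eqI)
    show "sets (contaminated p \<epsilon> \<Sigma> Q) = sets (mvn p \<Sigma>')" by (simp add: sets_contaminated sets_mvn)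
    fix B assume "B \<in> sets (contaminated p \<epsilon> \<Sigma> Q)"
    then have B: "B \<in> sets (borel_pow p)" by (simp add: sets_contaminated)
    show "emeasure (contaminated p \<epsilon> \<Sigma> Q) B = emeasure (mvn p \<Sigma>') B"
      unfolding emeasure_contaminated[OF Q B] eQ[OF B] by (rule add_diff_inverse_ennreal[OF dom[OF B]])
  qed
  then show thesis using that Q by blast
qed

text \<open>
  Two variances whose ratio of standard deviations is \<open>1 - \<epsilon> / 2\<close> give identical laws of the data: the
  smaller variance with a suitable contamination, and the larger one contaminated by itself. The two error
  probabilities of any test then add up to \<open>1\<close>, for every sample size.
\<close>
lemma minimax_lower_bound_contamination:
  assumes M: "0 < M" and p: "0 < p" and \<epsilon>: "0 < \<epsilon>" "\<epsilon> \<le> 1" and r: "r \<le> M\<^sup>2 / 32 * \<epsilon>\<^sup>2"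
  shows "ennreal (1 / 4) \<le> (INF \<Sigma>' \<in> estimators n p. SUP \<Sigma> \<in> cov_class p M. SUP Q \<in> distributions p.
    emeasure (sample_law n p \<epsilon> \<Sigma> Q)
      {x \<in> space (sample_law n p \<epsilon> \<Sigma> Q). (op_norm (\<Sigma>' x - \<Sigma>))\<^sup>2 \<ge> r})"
proof -
  define \<tau> where "\<tau> = sqrt M"
  (* Domination needs \<sigma> / \<tau> \<ge> 1 - \<epsilon>; the factor 1 / 2 keeps \<sigma> positive when \<epsilon> = 1. *)
  define \<sigma> where "\<sigma> = (1 - \<epsilon> / 2) * \<tau>"
  have \<tau>: "0 < \<tau>" "\<tau>\<^sup>2 = M" using M by (auto simp: \<tau>_def)
  have \<sigma>: "0 < \<sigma>" "\<sigma> \<le> \<tau>" using \<epsilon> \<tau> by (auto simp: \<sigma>_def mult_le_cancel_right1)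
  have \<epsilon>01: "\<epsilon> \<in> {0..1}" using \<epsilon> by simp
  have dens: "ennreal (1 - \<epsilon>) * ennreal (normal_density 0 \<sigma> x) \<le> ennreal (normal_density 0 \<tau> x)" for x
  proof -
    have "(1 - \<epsilon>) * normal_density 0 \<sigma> x \<le> \<sigma> / \<tau> * normal_density 0 \<sigma> x"
      using \<tau> \<epsilon> by (intro mult_right_mono) (auto simp: \<sigma>_def)
    also have "\<dots> \<le> normal_density 0 \<tau> x" by (rule normal_scale_dominated[OF \<sigma>])
    finally show ?thesis using \<epsilon> by (simp flip: ennreal_mult')
  qed
  have dom: "ennreal (1 - \<epsilon>) * emeasure (mvn p (axis_cov p \<sigma>)) B \<le> emeasure (mvn p (axis_cov p \<tau>)) B"
    if B: "B \<in> sets (borel_pow p)" for B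
  proof -
    let ?B = "axis_embedding p -` B"
    have mB: "?B \<in> sets borel" using measurable_sets[OF measurable_axis_embedding B] by simp
    have e: "emeasure (mvn p (axis_cov p s)) B = (\<integral>\<^sup>+x. ennreal (normal_density 0 s x) * indicator ?B x \<partial>lborel)"
      if "0 < s" for s
      unfolding axis_mvn[OF p that]
      using mB B measurable_axis_embedding by (simp add: emeasure_distr emeasure_density)
    have "ennreal (1 - \<epsilon>) * emeasure (mvn p (axis_cov p \<sigma>)) B
      = (\<integral>\<^sup>+x. ennreal (1 - \<epsilon>) * (ennreal (normal_density 0 \<sigma> x) * indicator ?B x) \<partial>lborel)"
      unfolding e[OF \<sigma>(1)] using mB by (intro nn_integral_cmult[symmetric]) simp
    also have "\<dots> \<le> emeasure (mvn p (axis_cov p \<tau>)) B"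
      unfolding e[OF \<tau>(1)] mult.assoc[symmetric] by (intro nn_integral_mono mult_right_mono dens) simp
    finally show ?thesis .
  qed
  obtain Q where Q: "Q \<in> distributions p" "contaminated p \<epsilon> (axis_cov p \<sigma>) Q = mvn p (axis_cov p \<tau>)"
    using contaminated_eq_of_dominated[OF \<epsilon> dom] by blast
  show ?thesis
  proof (rule minimax_lower_bound_by_variance[OF p \<epsilon>01 _ \<sigma> _ Q(1) mvn_in_distributions])
    show "\<tau>\<^sup>2 \<le> M" using \<tau> by simp
    fix E assume E: "E \<in> sets (Pi\<^sub>M {..<n} (\<lambda>_. borel_pow p))"
    let ?P = "Pi\<^sub>M {..<n} (\<lambda>_. mvn p (axis_cov p \<tau>))"
    interpret P: prob_space ?P by (intro prob_space_PiM prob_space_mvn)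
    have sets: "sets ?P = sets (Pi\<^sub>M {..<n} (\<lambda>_. borel_pow p))" by (intro sets_PiM_cong refl sets_mvn)
    have "measure ?P (space ?P - E) = 1 - measure ?P E" using E sets by (intro P.prob_compl) simp
    then show "1 \<le> measure (sample_law n p \<epsilon> (axis_cov p \<sigma>) Q) E
      + measure (sample_law n p \<epsilon> (axis_cov p \<tau>) (mvn p (axis_cov p \<tau>))) (space (Pi\<^sub>M {..<n} (\<lambda>_. borel_pow p)) - E)"
      unfolding sample_law_def Q(2) self_contaminated[OF \<epsilon>01] using sets_eq_imp_space_eq[OF sets] by simp
  next
    have "3 / 8 * M * \<epsilon> \<le> (\<tau>\<^sup>2 - \<sigma>\<^sup>2) / 2"
    proof -
      have "\<epsilon> * \<epsilon> \<le> \<epsilon> * 1" using \<epsilon> by (intro mult_left_mono) auto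
      then have "M * (3 / 4 * \<epsilon>) \<le> M * (\<epsilon> - \<epsilon> * \<epsilon> / 4)" using M by (intro mult_left_mono) auto
      also have "\<dots> = \<tau>\<^sup>2 - \<sigma>\<^sup>2"
        unfolding \<sigma>_def power_mult_distrib \<tau>(2) by (simp add: power2_eq_square algebra_simps)
      finally show ?thesis by simp
    qed
    then have "(3 / 8 * M * \<epsilon>)\<^sup>2 \<le> ((\<tau>\<^sup>2 - \<sigma>\<^sup>2) / 2)\<^sup>2"
      using \<epsilon> M by (intro power_mono) auto
    moreover have "(3 / 8 * M * \<epsilon>)\<^sup>2 = 9 / 64 * (M\<^sup>2 * \<epsilon>\<^sup>2)"
      by (simp add: power2_eq_square)
    moreover have "r \<le> 9 / 64 * (M\<^sup>2 * \<epsilon>\<^sup>2) / 4"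
    proof -
      have "0 \<le> M\<^sup>2 * \<epsilon>\<^sup>2" by simp
      moreover have "r \<le> M\<^sup>2 * \<epsilon>\<^sup>2 / 32" using r by simp
      ultimately show ?thesis by linarith
    qed
    ultimately show "r \<le> ((\<tau>\<^sup>2 - \<sigma>\<^sup>2) / 2)\<^sup>2 * 1 / 4"
      by linarith
  qed simp
qed

section \<open>The minimax lower bound\<close>

theorem theorem3p2:
  fixes M K :: real
  assumes "M > 0"
  shows "\<exists>C>0. \<exists>c>0. \<forall>(p::nat) (n::nat) (\<epsilon>::real).
    1 \<le> p \<longrightarrow> 1 \<le> n \<longrightarrow> real p / real n \<le> K \<longrightarrow> \<epsilon> \<in> {0..1} \<longrightarrow>
    (INF \<Sigma>' \<in> estimators n p. SUP \<Sigma> \<in> cov_class p M. SUP Q \<in> distributions p.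
       emeasure (sample_law n p \<epsilon> \<Sigma> Q)
         {x \<in> space (sample_law n p \<epsilon> \<Sigma> Q).
            (op_norm (\<Sigma>' x - \<Sigma>))\<^sup>2 \<ge> C * max (real p / real n) (\<epsilon>\<^sup>2)}) \<ge> ennreal c"
proof -
  (* Chosen so that \<kappa> \<le> 1 / 2 and \<kappa> p / n \<le> 1 whenever p / n \<le> K. *)
  define \<kappa> where "\<kappa> = 1 / (2 + 2 * \<bar>K\<bar>)"
  define C where "C = M\<^sup>2 * \<kappa> / 288"
  have \<kappa>: "0 < \<kappa>" "\<kappa> \<le> 1 / 2" "\<kappa> * \<bar>K\<bar> \<le> 1"
    by (auto simp: \<kappa>_def field_simps)
  have C: "0 < C" unfolding C_def using \<kappa> assms by simp
  have "M\<^sup>2 * \<kappa> \<le> M\<^sup>2 * 1" using \<kappa> by (intro mult_left_mono) auto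
  moreover have "0 \<le> M\<^sup>2" by simp
  ultimately have C_le: "C \<le> M\<^sup>2 / 128" "C \<le> M\<^sup>2 / 32" unfolding C_def by linarith+
  show ?thesis
  proof (rule exI[of _ C], rule conjI[OF C], rule exI[of _ "1 / 16"], intro conjI allI impI)
    show "0 < (1 / 16 :: real)" by simp
    fix p n :: nat and \<epsilon> :: real
    assume p: "1 \<le> p" and n: "1 \<le> n" and K: "real p / real n \<le> K" and \<epsilon>: "\<epsilon> \<in> {0..1}"
    let ?r = "C * max (real p / real n) (\<epsilon>\<^sup>2)"
    show "ennreal (1 / 16) \<le> (INF \<Sigma>' \<in> estimators n p. SUP \<Sigma> \<in> cov_class p M. SUP Q \<in> distributions p.
       emeasure (sample_law n p \<epsilon> \<Sigma> Q)
         {x \<in> space (sample_law n p \<epsilon> \<Sigma> Q). (op_norm (\<Sigma>' x - \<Sigma>))\<^sup>2 \<ge> ?r})"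
    proof (cases "\<epsilon>\<^sup>2 \<le> real p / real n")
      case True
      then have r: "?r = C * (real p / real n)" by (simp add: max_def)
      show ?thesis
      proof (cases "p = 1")
        case True
        have "C * (real p / real n) \<le> M\<^sup>2 / 128 * (1 / real n)"
          unfolding True using C_le by (intro mult_mono) auto
        then show ?thesis
          using p r by (intro minimax_lower_bound_sampling[OF assms _ n \<epsilon>]) auto
      next
        case False
        have "\<kappa> * (real p / real n) \<le> \<kappa> * \<bar>K\<bar>" using K \<kappa> by (intro mult_left_mono) auto
        then show ?thesis
          using False p \<kappa> r by (intro minimax_lower_bound_dimension[OF assms _ n \<epsilon>, of _ \<kappa>]) (auto simp: C_def)
      qed
    next
      case False
      then have "\<epsilon>\<^sup>2 \<noteq> 0" using n by (metis divide_nonneg_nonneg of_nat_0_le_iff)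
      then have \<epsilon>0: "0 < \<epsilon>" "\<epsilon> \<le> 1" using \<epsilon> by auto
      have "?r = C * \<epsilon>\<^sup>2" using False by (simp add: max_def)
      also have "\<dots> \<le> M\<^sup>2 / 32 * \<epsilon>\<^sup>2" using C_le by (intro mult_right_mono) auto
      finally have "ennreal (1 / 4) \<le> (INF \<Sigma>' \<in> estimators n p. SUP \<Sigma> \<in> cov_class p M. SUP Q \<in> distributions p.
         emeasure (sample_law n p \<epsilon> \<Sigma> Q)
           {x \<in> space (sample_law n p \<epsilon> \<Sigma> Q). (op_norm (\<Sigma>' x - \<Sigma>))\<^sup>2 \<ge> ?r})"
        using p by (intro minimax_lower_bound_contamination[OF assms _ \<epsilon>0]) auto
      then show ?thesis by (rule order_trans[rotated]) (simp add: ennreal_leI)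
    qed
  qed
qed

end
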